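(* Let $p\in(0,\infty]$ and $b>0$. Let $f\in PW_b^p$ be real-valued on $\mathbb{R}$, and let $X=\{x_k\}_{k\in\mathbb{Z}}\subset\mathbb{R}$ be a separated, uniformly dense sequence with $D(X)>2b$. Then $f$ is uniquely determined, up to a sign factor, by the values $a_k=|f(x_k)|$, $k\in\mathbb{Z}$; that is, if $g\in PW_b^p$ is real-valued on $\mathbb{R}$ and $|g(x_k)|=|f(x_k)|$ for all $k\in\mathbb{Z}$, then $g=f$ or $g=-f$.
   Context: The Fourier transform is normalized as $\hat f(\omega)=\int_{-\infty}^{\infty}f(t)e^{-2\pi i\omega t}\,dt$ for Schwartz functions and extended to tempered distributions in the usual way. For $0<p\le\infty$ and $b>0$, the Paley-Wiener space is $PW_b^p=\{f\in L^p(\mathbb{R}):\operatorname{supp}(\hat f)\subset[-\tfrac b2,\tfrac b2]\}$ (complex-valued functions). Equivalently (Paley-Wiener-Schwartz), $PW_b^p$ is the space of all entire functions $f$ of exponential type at most $\pi b$ whose restrictions to $\mathbb{R}$ are in $L^p$; elements are identified with these entire functions, so point values make sense. The exponential type of an entire function $g$ is $\inf\{\beta: |g(z)|\le e^{\beta|z|},\ z\in\mathbb{C}\}$, understood in the usual sense, i.e. up to a multiplicative constant. A sequence $X=\{x_k\}_{k\in\mathbb{Z}}\subset\mathbb{R}$ is indexed so that $x_k<x_{k+1}$. It is separated if $\inf_k|x_{k+1}-x_k|>0$. It is uniformly dense if $\sup_k|x_k-\tfrac kd|<\infty$ for some finite $d>0$; in this case one writes $D(X)=d$. *)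

theory Defs
  imports "HOL-Analysis.Analysis"
begin

section \<open>Fourier transform and support of distributions on the real line\<close>

definition fourier :: "(real \<Rightarrow> complex) \<Rightarrow> real \<Rightarrow> complex" where
  "fourier f \<omega> = (LINT t|lborel. f t * exp (- (2 * of_real pi * \<i> * of_real \<omega> * of_real t)))"

definition smooth :: "(real \<Rightarrow> complex) \<Rightarrow> bool" where
  "smooth \<phi> \<longleftrightarrow> (\<forall>n t. ((\<lambda>g s. vector_derivative g (at s)) ^^ n) \<phi> differentiable (at t))"

definition tsupp :: "(real \<Rightarrow> complex) \<Rightarrow> real set" where
  "tsupp \<phi> = closure {t. \<phi> t \<noteq> 0}"

definition test_functions_on :: "real set \<Rightarrow> (real \<Rightarrow> complex) set" where
  "test_functions_on U = {\<phi>. smooth \<phi> \<and> compact (tsupp \<phi>) \<and> tsupp \<phi> \<subseteq> U}"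

text \<open>A distribution is represented by the functional through which it acts on functions.
  Its support is the complement of the largest open set on which it vanishes.\<close>

definition dist_support :: "((real \<Rightarrow> complex) \<Rightarrow> complex) \<Rightarrow> real set" where
  "dist_support T = - \<Union>{U. open U \<and> (\<forall>\<phi>\<in>test_functions_on U. T \<phi> = 0)}"

definition regular_dist :: "(real \<Rightarrow> complex) \<Rightarrow> (real \<Rightarrow> complex) \<Rightarrow> complex" where
  "regular_dist f \<phi> = (LINT t|lborel. f t * \<phi> t)"

definition dist_fourier :: "((real \<Rightarrow> complex) \<Rightarrow> complex) \<Rightarrow> (real \<Rightarrow> complex) \<Rightarrow> complex" where
  "dist_fourier T \<phi> = T (fourier \<phi>)"

text \<open>The standard condition under which \<^term>\<open>regular_dist f\<close> is a tempered distribution.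
  It is automatic for \<open>f \<in> L\<^sup>p\<close> with \<open>p \<ge> 1\<close> (take \<open>N = 2\<close>). For \<open>p < 1\<close> an \<open>L\<^sup>p\<close> function
  need not be locally integrable, and the condition is what gives its Fourier transform a meaning.\<close>

definition tempered_function :: "(real \<Rightarrow> complex) \<Rightarrow> bool" where
  "tempered_function f \<longleftrightarrow> f \<in> borel_measurable lborel \<and>
     (\<exists>N::nat. integrable lborel (\<lambda>t. cmod (f t) / (1 + \<bar>t\<bar>) ^ N))"


section \<open>Paley-Wiener spaces\<close>

definition Lp :: "ennreal \<Rightarrow> (real \<Rightarrow> complex) set" where
  "Lp p = {f \<in> borel_measurable lborel.
     if p = \<infinity> then \<exists>C. AE t in lborel. cmod (f t) \<le> C
     else integrable lborel (\<lambda>t. cmod (f t) powr enn2real p)}"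

definition PW_real :: "ennreal \<Rightarrow> real \<Rightarrow> (real \<Rightarrow> complex) set" where
  "PW_real p b = {f \<in> Lp p. tempered_function f \<and>
     dist_support (dist_fourier (regular_dist f)) \<subseteq> {- b / 2 .. b / 2}}"

text \<open>The elements of \<^const>\<open>PW_real\<close> are determined only almost everywhere. Each class has a
  unique representative that extends to an entire function (Paley-Wiener-Schwartz), and as usual
  it is identified with that entire function, so that point values make sense.\<close>

definition PW :: "ennreal \<Rightarrow> real \<Rightarrow> (complex \<Rightarrow> complex) set" where
  "PW p b = {F. F holomorphic_on UNIV \<and> (\<lambda>t. F (of_real t)) \<in> PW_real p b}"

definition real_on_reals :: "(complex \<Rightarrow> complex) \<Rightarrow> bool" where
  "real_on_reals F \<longleftrightarrow> (\<forall>t::real. F (of_real t) \<in> \<real>)"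


section \<open>Separated and uniformly dense sequences\<close>

definition separated :: "(int \<Rightarrow> real) \<Rightarrow> bool" where
  "separated x \<longleftrightarrow> (INF k. \<bar>x (k + 1) - x k\<bar>) > 0"

definition has_uniform_density :: "(int \<Rightarrow> real) \<Rightarrow> real \<Rightarrow> bool" where
  "has_uniform_density x d \<longleftrightarrow> d > 0 \<and> bdd_above (range (\<lambda>k. \<bar>x k - of_int k / d\<bar>))"

definition uniformly_dense :: "(int \<Rightarrow> real) \<Rightarrow> bool" where
  "uniformly_dense x \<longleftrightarrow> (\<exists>d. has_uniform_density x d)"

definition uniform_density :: "(int \<Rightarrow> real) \<Rightarrow> real" where
  "uniform_density x = (THE d. has_uniform_density x d)"

lemma has_uniform_density_unique:
  assumes "has_uniform_density x d" "has_uniform_density x d'"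
  shows "d = d'"
proof (rule ccontr)
  assume "d \<noteq> d'"
  have pos: "d > 0" "d' > 0" using assms by (auto simp: has_uniform_density_def)
  define e where "e = \<bar>1 / d - 1 / d'\<bar>"
  have "e > 0" using \<open>d \<noteq> d'\<close> pos by (auto simp: e_def)
  obtain A where A: "\<And>k. \<bar>x k - of_int k / d\<bar> \<le> A"
    using assms(1) by (auto simp: has_uniform_density_def bdd_above_def)
  obtain B where B: "\<And>k. \<bar>x k - of_int k / d'\<bar> \<le> B"
    using assms(2) by (auto simp: has_uniform_density_def bdd_above_def)
  obtain n :: nat where n: "A + B < of_nat n * e"
    using ex_less_of_nat_mult[OF \<open>e > 0\<close>] by blast
  have "real n * e = \<bar>real n * (1 / d - 1 / d')\<bar>"
    by (simp add: e_def abs_mult)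
  also have "\<dots> = \<bar>real n / d - real n / d'\<bar>"
    by (simp add: right_diff_distrib)
  also have "\<dots> \<le> A + B"
    using A[of "int n"] B[of "int n"] by simp
  finally show False using n by simp
qed

lemma uniform_density_eq:
  assumes "has_uniform_density x d"
  shows "uniform_density x = d"
  unfolding uniform_density_def using assms has_uniform_density_unique by blast

end

theory Submission
  imports Defs "HOL-Complex_Analysis.Complex_Analysis" "HOL-Probability.Probability"
    "HOL-Real_Asymp.Real_Asymp"
begin

text \<open>If \<open>f\<close> and \<open>g\<close> agree in modulus on \<open>X\<close>, then \<open>h = f\<^sup>2 - g\<^sup>2\<close> vanishes on \<open>X\<close>, because
  both functions are real there. The Fourier support of \<open>f\<close> and \<open>g\<close> gives
  \<open>\<bar>h z\<bar> \<le> C (1 + \<bar>z\<bar>)\<^sup>N exp (\<tau> \<bar>Im z\<bar>)\<close> for every \<open>\<tau> > 2\<pi>b\<close>: against a smooth cutoff of the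
  frequencies, \<open>f\<close> is a convolution of its restriction to the reals with an entire kernel of that
  type. On a circle of radius \<open>R\<close> the mean of \<open>\<tau> \<bar>Im z\<bar>\<close> is \<open>2\<tau>R/\<pi>\<close>, so by Jensen's inequality \<open>h\<close>
  cannot have zeros of density exceeding \<open>\<tau>/\<pi>\<close> unless it vanishes identically. Hence
  \<open>(f - g)(f + g) = 0\<close>, and one of the two entire factors is zero.\<close>

section \<open>Smooth functions\<close>

text \<open>The exponent must contain |Im z|. Exponential type alone gives \<tau> |z|, whose mean
  over the circle is \<tau> R instead of 2 \<tau> R / \<pi>, and the critical density would be off
  by the factor \<pi>/2. Hence the growth bound is drawn from the Fourier support. The obstacle is
  that \<open>f\<close> is only tempered on the real line, so its transform is a distribution that
  can be probed through test functions alone. Dilating a cutoff that equals 1 near the spectrum does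
  not change its pairing with the transform, while the transforms of the dilated cutoffs form an
  approximate identity. Comparing the two gives the convolution formula up to a nonzero constant.
  The cutoff needs room beyond the band, and the strict inequality D(X) > 2b supplies it. The mean
  over the circle is discretised by rotations, the zeros are traded for Blaschke factors, and the
  product of the resulting gains R/|x_k| is estimated by factorials. All losses are polynomial in R,
  so only the exponential rates are compared.\<close>

abbreviation vderiv :: "(real \<Rightarrow> complex) \<Rightarrow> real \<Rightarrow> complex" where
  "vderiv g \<equiv> \<lambda>s. vector_derivative g (at s)"

text \<open>Peeling off the first derivative instead of the last lets the closure properties go by
  induction with the function arbitrary. The index is off by one: \<open>kdiff n\<close> makes the
  derivatives of orders 0 to n differentiable.\<close>

primrec kdiff :: "nat \<Rightarrow> (real \<Rightarrow> complex) \<Rightarrow> bool" where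
  "kdiff 0 g \<longleftrightarrow> (\<forall>t. g differentiable at t)"
| "kdiff (Suc n) g \<longleftrightarrow> (\<forall>t. g differentiable at t) \<and> kdiff n (vderiv g)"

lemma kdiff_iff: "kdiff n g \<longleftrightarrow> (\<forall>m<Suc n. \<forall>t. (vderiv ^^ m) g differentiable at t)"
proof (induction n arbitrary: g)
  case (Suc n)
  show ?case
    unfolding All_less_Suc2[of "Suc n"] kdiff.simps Suc.IH
    by (simp only: funpow_Suc_right o_apply funpow_0)
qed simp

lemma smooth_iff_kdiff: "smooth g \<longleftrightarrow> (\<forall>n. kdiff n g)"
  unfolding smooth_def kdiff_iff by blast

lemma kdiff_differentiable: "kdiff n g \<Longrightarrow> g differentiable at t"
  by (cases n) auto

lemma smooth_differentiable: "smooth g \<Longrightarrow> g differentiable at t"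
  using smooth_iff_kdiff kdiff_differentiable by blast

lemma smooth_vderiv: "smooth g \<Longrightarrow> smooth (vderiv g)"
  unfolding smooth_iff_kdiff using kdiff.simps(2) by blast

lemma smooth_has_vector_derivative: "smooth g \<Longrightarrow> (g has_vector_derivative vderiv g t) (at t)"
  using smooth_differentiable vector_derivative_works by blast

lemma smooth_continuous_on: "smooth g \<Longrightarrow> continuous_on A g"
  by (meson continuous_at_imp_continuous_on differentiable_imp_continuous_within smooth_differentiable)

lemma kdiff_Suc_D: "kdiff (Suc n) g \<Longrightarrow> kdiff n g"
  unfolding kdiff_iff by simp

text \<open>Allows any exhibited derivative \<open>g'\<close>, whose shape can be fitted to an
  induction hypothesis, in place of the opaque \<open>vderiv g\<close>.\<close>

lemma kdiff_SucI:
  assumes "\<And>t. (g has_vector_derivative g' t) (at t)" "kdiff n g'"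
  shows "kdiff (Suc n) g"
proof -
  have "vderiv g = g'" using assms(1) vector_derivative_at by blast
  then show ?thesis using assms differentiableI_vector by auto
qed

lemma kdiff_0I: "(\<And>t. (g has_vector_derivative g' t) (at t)) \<Longrightarrow> kdiff 0 g"
  using differentiableI_vector by auto

lemma kdiff_has_vector_derivative: "kdiff n g \<Longrightarrow> (g has_vector_derivative vderiv g t) (at t)"
  using kdiff_differentiable vector_derivative_works by blast

lemma kdiff_vderiv: "kdiff (Suc n) g \<Longrightarrow> kdiff n (vderiv g)"
  by simp

lemma kdiff_const: "kdiff n (\<lambda>_. c)"
proof (induction n arbitrary: c)
  case (Suc n)
  show ?case by (rule kdiff_SucI[of _ "\<lambda>_. 0"]) (auto intro!: derivative_eq_intros Suc)
qed simp

lemma kdiff_add: "kdiff n f \<Longrightarrow> kdiff n g \<Longrightarrow> kdiff n (\<lambda>t. f t + g t)"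
proof (induction n arbitrary: f g)
  case (Suc n)
  note f' = kdiff_has_vector_derivative[OF Suc.prems(1)] kdiff_vderiv[OF Suc.prems(1)]
  note g' = kdiff_has_vector_derivative[OF Suc.prems(2)] kdiff_vderiv[OF Suc.prems(2)]
  show ?case
    by (rule kdiff_SucI[OF _ Suc.IH[OF f'(2) g'(2)]]) (auto intro!: derivative_eq_intros f' g')
qed simp

lemma kdiff_mult: "kdiff n f \<Longrightarrow> kdiff n g \<Longrightarrow> kdiff n (\<lambda>t. f t * g t)"
proof (induction n arbitrary: f g)
  case (Suc n)
  note f' = kdiff_has_vector_derivative[OF Suc.prems(1)] kdiff_vderiv[OF Suc.prems(1)]
  note g' = kdiff_has_vector_derivative[OF Suc.prems(2)] kdiff_vderiv[OF Suc.prems(2)]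
  have "kdiff n (\<lambda>t. f t * vderiv g t + vderiv f t * g t)"
    by (intro kdiff_add Suc.IH f' g' Suc.prems[THEN kdiff_Suc_D])
  then show ?case
    by (rule kdiff_SucI[rotated]) (intro has_vector_derivative_mult f' g')
qed simp

lemma kdiff_inverse: "kdiff n g \<Longrightarrow> (\<And>t. g t \<noteq> 0) \<Longrightarrow> kdiff n (\<lambda>t. inverse (g t))"
proof (induction n)
  case 0
  note g' = kdiff_has_vector_derivative[OF 0(1)]
  have "((\<lambda>t. inverse (g t)) has_vector_derivative vderiv g t * - (inverse (g t) ^ 2)) (at t)" for t
    using field_vector_diff_chain_at[OF g'[of t], of inverse "- (inverse (g t) ^ 2)"]
      DERIV_inverse[OF 0(2)[of t], of UNIV]
    by (simp add: o_def numeral_2_eq_2)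
  then show ?case by (rule kdiff_0I)
next
  case (Suc n)
  note g' = kdiff_has_vector_derivative[OF Suc.prems(1)] kdiff_vderiv[OF Suc.prems(1)]
  \<comment> \<open>The square is expanded and the sign written as a factor -1, so that
    \<open>kdiff_mult\<close>, \<open>kdiff_const\<close> and the induction hypothesis apply
    literally.\<close>
  have d: "((\<lambda>t. inverse (g t)) has_vector_derivative vderiv g t * (-1 * (inverse (g t) * inverse (g t)))) (at t)" for t
    using field_vector_diff_chain_at[OF g'(1)[of t], of inverse "- (inverse (g t) ^ 2)"]
      DERIV_inverse[OF Suc.prems(2)[of t], of UNIV]
    by (simp add: o_def numeral_2_eq_2)
  have "kdiff n (\<lambda>t. vderiv g t * (-1 * (inverse (g t) * inverse (g t))))"
    by (intro kdiff_mult kdiff_const Suc.IH g' Suc.prems(1)[THEN kdiff_Suc_D] Suc.prems)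
  then show ?case by (rule kdiff_SucI[OF d])
qed

lemma has_vector_derivative_affine:
  assumes "(g has_vector_derivative g') (at (a * t + c))"
  shows "((\<lambda>t. g (a * t + c)) has_vector_derivative (of_real a * g' :: complex)) (at t)"
proof -
  have "((\<lambda>t. a * t + c) has_vector_derivative a) (at t)"
    by (auto intro!: derivative_eq_intros)
  from vector_diff_chain_at[OF this assms] show ?thesis
    by (simp add: o_def scaleR_conv_of_real)
qed

lemma kdiff_affine: "kdiff n g \<Longrightarrow> kdiff n (\<lambda>t. g (a * t + c))"
proof (induction n arbitrary: g)
  case 0
  show ?case
    by (rule kdiff_0I[OF has_vector_derivative_affine[OF kdiff_has_vector_derivative[OF 0]]])
next
  case (Suc n)
  show ?case
    by (rule kdiff_SucI[OF has_vector_derivative_affine[OF kdiff_has_vector_derivative[OF Suc.prems]]])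
      (intro kdiff_mult kdiff_const Suc.IH kdiff_vderiv Suc.prems)
qed

lemma kdiff_exp: "kdiff n (\<lambda>t. exp (c * of_real t))"
proof (induction n)
  case 0
  have "((\<lambda>t. exp (c * of_real t)) has_vector_derivative c * exp (c * of_real t)) (at t)" for t
    by (rule has_vector_derivative_real_field) (auto intro!: derivative_eq_intros)
  then show ?case by (rule kdiff_0I)
next
  case (Suc n)
  have d: "((\<lambda>t. exp (c * of_real t)) has_vector_derivative c * exp (c * of_real t)) (at t)" for t
    by (rule has_vector_derivative_real_field) (auto intro!: derivative_eq_intros)
  show ?case by (rule kdiff_SucI[OF d]) (intro kdiff_mult kdiff_const Suc.IH)
qed

lemma smooth_const: "smooth (\<lambda>_. c)"
  and smooth_add: "smooth f \<Longrightarrow> smooth g \<Longrightarrow> smooth (\<lambda>t. f t + g t)"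
  and smooth_mult: "smooth f \<Longrightarrow> smooth g \<Longrightarrow> smooth (\<lambda>t. f t * g t)"
  and smooth_inverse: "smooth g \<Longrightarrow> (\<And>t. g t \<noteq> 0) \<Longrightarrow> smooth (\<lambda>t. inverse (g t))"
  and smooth_affine: "smooth g \<Longrightarrow> smooth (\<lambda>t. g (a * t + b))"
  and smooth_exp: "smooth (\<lambda>t. exp (c * of_real t))"
  unfolding smooth_iff_kdiff
  by (auto intro: kdiff_const kdiff_add kdiff_mult kdiff_inverse kdiff_affine kdiff_exp)

lemma smooth_diff: "smooth f \<Longrightarrow> smooth g \<Longrightarrow> smooth (\<lambda>t. f t - g t)"
  using smooth_add[OF _ smooth_mult[OF smooth_const[of "-1"]], of f g] by simp

section \<open>Smooth steps built from exp(-1/t)\<close>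

definition flat :: "real poly \<Rightarrow> real \<Rightarrow> real" where
  "flat p t = (if t > 0 then poly p (1 / t) * exp (- (1 / t)) else 0)"

lemma poly_div_exp_tendsto_0: "((\<lambda>s. poly p s * exp (- s)) \<longlongrightarrow> (0::real)) at_top"
proof -
  have "((\<lambda>s. (\<Sum>i\<le>degree p. coeff p i * (s ^ i / exp s))) \<longlongrightarrow> (\<Sum>i\<le>degree p. coeff p i * 0)) at_top"
    by (intro tendsto_intros tendsto_power_div_exp_0)
  then show ?thesis
    unfolding poly_altdef sum_distrib_right by (simp add: exp_minus divide_inverse mult_ac)
qed

text \<open>In terms of s = 1/t the derivative of p(s) exp(-s) is s^2 (p(s) - p'(s)) exp(-s). The
  polynomial factor in \<open>flat\<close> is there to make the family closed under differentiation,
  so smoothness follows by induction.\<close>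

lemma flat_has_derivative:
  "(flat p has_real_derivative flat ([:0, 0, 1:] * (p - pderiv p)) t) (at t)"
proof -
  consider "t > 0" | "t < 0" | "t = 0" by linarith
  then show ?thesis
  proof cases
    case 1
    have "((\<lambda>t. poly p (1 / t) * exp (- (1 / t))) has_real_derivative
       flat ([:0, 0, 1:] * (p - pderiv p)) t) (at t)"
      using 1
      by (auto intro!: derivative_eq_intros DERIV_chain2[OF poly_DERIV] simp: flat_def)
         (simp add: field_simps power2_eq_square)
    then show ?thesis
      by (rule has_field_derivative_transform_within[where d = t]) (use 1 in \<open>auto simp: flat_def dist_real_def\<close>)
  next
    case 2
    have "((\<lambda>t. 0) has_real_derivative flat ([:0, 0, 1:] * (p - pderiv p)) t) (at t)"
      using 2 by (auto simp: flat_def)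
    then show ?thesis
      by (rule has_field_derivative_transform_within[where d = "-t"]) (use 2 in \<open>auto simp: flat_def dist_real_def\<close>)
  next
    case 3
    \<comment> \<open>Dividing by h multiplies the polynomial by \<open>[:0, 1:]\<close>, so the
      quotient on the right is again a polynomial in 1/h times exp(-1/h).\<close>
    have "((\<lambda>h. flat p h / h) \<longlongrightarrow> 0) (at 0)"
    proof (rule filterlim_split_at)
      have "((\<lambda>h. poly ([:0, 1:] * p) (inverse h) * exp (- inverse h)) \<longlongrightarrow> 0) (at_right (0::real))"
        using poly_div_exp_tendsto_0 filterlim_inverse_at_top_right by (rule filterlim_compose)
      then show "((\<lambda>h. flat p h / h) \<longlongrightarrow> 0) (at_right 0)"
        by (rule Lim_transform_eventually)
          (auto simp: flat_def eventually_at_right_field divide_inverse intro!: exI[of _ 1])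
      show "((\<lambda>h. flat p h / h) \<longlongrightarrow> 0) (at_left 0)"
        by (rule tendsto_eventually) (auto simp: flat_def eventually_at_left_field intro!: exI[of _ "-1"])
    qed
    then show ?thesis using 3 by (simp add: DERIV_def flat_def)
  qed
qed

lemma smooth_flat: "smooth (\<lambda>t. of_real (flat p t))"
proof -
  have "kdiff n (\<lambda>t. of_real (flat p t))" for n
  proof (induction n arbitrary: p)
    case 0
    show ?case
      by (rule kdiff_0I[OF has_vector_derivative_of_real[OF flat_has_derivative]])
  next
    case (Suc n)
    show ?case
      by (rule kdiff_SucI[OF has_vector_derivative_of_real[OF flat_has_derivative] Suc.IH])
  qed
  then show ?thesis by (simp add: smooth_iff_kdiff)
qed

lemma smooth_step_exists:
  obtains s :: "real \<Rightarrow> real" where "smooth (\<lambda>t. complex_of_real (s t))"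
    "\<And>t. t \<le> 0 \<Longrightarrow> s t = 0" "\<And>t. t \<ge> 1 \<Longrightarrow> s t = 1" "\<And>t. 0 \<le> s t"
proof
  \<comment> \<open>The classical quotient e(t) / (e(t) + e(1 - t)). For every t one of t and 1 - t
    is positive, so the denominator never vanishes.\<close>
  let ?e = "\<lambda>t. flat 1 t" and ?e' = "\<lambda>t. flat 1 (- 1 * t + 1)"
  let ?s = "\<lambda>t. ?e t * inverse (?e t + ?e' t)"
  have pos: "?e t + ?e' t > 0" for t by (auto simp: flat_def add_pos_pos)
  have nn: "?e t \<ge> 0" for t by (auto simp: flat_def)
  have "smooth (\<lambda>t. of_real (?e t) * inverse (of_real (?e t) + of_real (?e' t)))"
  proof (intro smooth_mult smooth_inverse smooth_add smooth_flat)
    show "smooth (\<lambda>t. of_real (?e' t))"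
      using smooth_affine[OF smooth_flat, of 1 "-1" 1] by simp
    show "complex_of_real (?e t) + of_real (?e' t) \<noteq> 0" for t
      using pos[of t] by (metis less_numeral_extra(3) of_real_add of_real_eq_0_iff)
  qed
  then show "smooth (\<lambda>t. complex_of_real (?s t))" by simp
  show "?s t = 0" if "t \<le> 0" for t using that by (simp add: flat_def)
  show "?s t = 1" if "t \<ge> 1" for t using that by (simp add: flat_def)
  show "?s t \<ge> 0" for t using pos[of t] nn[of t] by simp
qed

section \<open>Fourier transforms of test functions at complex arguments\<close>

text \<open>The Fourier-Laplace transform. For continuous \<open>\<phi>\<close> of compact support
  it is entire, and it supplies the kernel of the convolution formula in
  \<open>PW_growth\<close>.\<close>

definition cfourier :: "(real \<Rightarrow> complex) \<Rightarrow> complex \<Rightarrow> complex" where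
  "cfourier \<phi> w = (LINT t|lborel. \<phi> t * exp (- (2 * of_real pi * \<i> * w * of_real t)))"

lemma fourier_eq_cfourier: "fourier \<phi> \<omega> = cfourier \<phi> (of_real \<omega>)"
  by (simp add: fourier_def cfourier_def)

lemma indicator_scaleR_eq:
  fixes f :: "real \<Rightarrow> complex"
  assumes "\<And>t. \<bar>t\<bar> > A \<Longrightarrow> f t = 0" "A \<le> B"
  shows "(\<lambda>t. indicator {-B..B} t *\<^sub>R f t) = f"
proof
  fix t
  show "indicator {-B..B} t *\<^sub>R f t = f t"
    using assms(1)[of t] assms(2) by (cases "\<bar>t\<bar> \<le> B") (auto simp: indicator_def)
qed

lemma integrable_compact_support:
  fixes \<phi> :: "real \<Rightarrow> complex"
  assumes "continuous_on UNIV \<phi>" "\<And>t. \<bar>t\<bar> > A \<Longrightarrow> \<phi> t = 0"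
  shows "integrable lborel \<phi>"
proof -
  have "set_integrable lborel {-A..A} \<phi>"
    by (rule borel_integrable_atLeastAtMost') (rule continuous_on_subset[OF assms(1)], simp)
  moreover have "(\<lambda>t. indicator {-A..A} t *\<^sub>R \<phi> t) = \<phi>"
    using assms(2) by (rule indicator_scaleR_eq) auto
  ultimately show ?thesis by (simp add: set_integrable_def)
qed

lemma integral_derivative_compact_support:
  fixes G :: "real \<Rightarrow> complex"
  assumes G: "\<And>t. (G has_vector_derivative g t) (at t)" and "continuous_on UNIV g"
    and zero: "\<And>t. \<bar>t\<bar> > A \<Longrightarrow> G t = 0" "\<And>t. \<bar>t\<bar> > A \<Longrightarrow> g t = 0"
  shows "(LINT t|lborel. g t) = 0"
proof -
  \<comment> \<open>Whatever the sign of \<open>A\<close>, both endpoints -B and B lie strictly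
    outside the support, so the boundary terms vanish.\<close>
  define B where "B = \<bar>A\<bar> + 1"
  have "(\<lambda>t. indicator {-B..B} t *\<^sub>R g t) = g"
    using zero(2) by (rule indicator_scaleR_eq) (auto simp: B_def)
  moreover have "(LINT t|lborel. indicator {-B..B} t *\<^sub>R g t) = G B - G (- B)"
    by (rule integral_FTC_Icc)
      (use assms in \<open>auto simp: B_def intro: continuous_on_subset has_vector_derivative_at_within\<close>)
  ultimately show ?thesis using zero(1)[of B] zero(1)[of "-B"] by (simp add: B_def)
qed

lemma vderiv_zero_outside:
  assumes "\<And>t. \<bar>t\<bar> > A \<Longrightarrow> \<phi> t = 0" "\<bar>t\<bar> > A"
  shows "vderiv \<phi> t = 0"
proof -
  have "(\<phi> has_vector_derivative 0) (at t)"
  proof (rule has_vector_derivative_transform_within_open[where S = "{t. \<bar>t\<bar> > A}"])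
    show "((\<lambda>_. 0) has_vector_derivative 0) (at t)" by simp
    show "open {t. \<bar>t\<bar> > A}" by (intro open_Collect_less continuous_intros)
  qed (use assms in auto)
  then show ?thesis by (rule vector_derivative_at)
qed

lemma integrable_cfourier:
  assumes "continuous_on UNIV \<phi>" "\<And>t. \<bar>t\<bar> > A \<Longrightarrow> \<phi> t = 0"
  shows "integrable lborel (\<lambda>t. \<phi> t * exp (- (2 * of_real pi * \<i> * w * of_real t)))"
  by (rule integrable_compact_support[of _ A]) (use assms in \<open>auto intro!: continuous_intros\<close>)

text \<open>Integration by parts, in the form that the derivative of \<phi>(t) exp(-ct) has integral
  0.\<close>

lemma cfourier_vderiv:
  assumes "smooth \<phi>" "\<And>t. \<bar>t\<bar> > A \<Longrightarrow> \<phi> t = 0"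
  shows "cfourier (vderiv \<phi>) w = 2 * of_real pi * \<i> * w * cfourier \<phi> w"
proof -
  define c where "c = 2 * of_real pi * \<i> * w"
  note cont = smooth_continuous_on[OF assms(1)] smooth_continuous_on[OF smooth_vderiv[OF assms(1)]]
  note z = vderiv_zero_outside[OF assms(2)]
  have "((\<lambda>t. \<phi> t * exp (- (c * of_real t))) has_vector_derivative
      \<phi> t * (- c * exp (- (c * of_real t))) + vderiv \<phi> t * exp (- (c * of_real t))) (at t)" for t
    by (intro has_vector_derivative_mult smooth_has_vector_derivative assms has_vector_derivative_real_field)
      (auto intro!: derivative_eq_intros)
  then have "(LINT t|lborel. \<phi> t * (- c * exp (- (c * of_real t))) + vderiv \<phi> t * exp (- (c * of_real t))) = 0"
    by (rule integral_derivative_compact_support[where A = A])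
      (use assms z in \<open>auto intro!: continuous_intros cont\<close>)
  moreover have "integrable lborel (\<lambda>t. \<phi> t * exp (- (c * of_real t)))"
    "integrable lborel (\<lambda>t. vderiv \<phi> t * exp (- (c * of_real t)))"
    unfolding c_def
    using integrable_cfourier[OF cont(1), of A w] integrable_cfourier[OF cont(2), of A w] assms(2) z by auto
  then have "(LINT t|lborel. (- c) * (\<phi> t * exp (- (c * of_real t))) + vderiv \<phi> t * exp (- (c * of_real t)))
    = (- c) * cfourier \<phi> w + cfourier (vderiv \<phi>) w"
    unfolding cfourier_def c_def[symmetric] by (subst Bochner_Integration.integral_add) auto
  ultimately show ?thesis unfolding c_def[symmetric] by (simp add: mult_ac)
qed

lemma norm_exp_fourier_le:
  assumes "\<bar>t\<bar> \<le> A"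
  shows "cmod (exp (- (2 * of_real pi * \<i> * w * of_real t))) \<le> exp (2 * pi * A * \<bar>Im w\<bar>)"
proof -
  have "t * Im w \<le> A * \<bar>Im w\<bar>"
    using abs_ge_self[of "t * Im w"] mult_right_mono[OF assms, of "\<bar>Im w\<bar>"] by (simp add: abs_mult)
  then have "2 * pi * (t * Im w) \<le> 2 * pi * (A * \<bar>Im w\<bar>)" by (intro mult_left_mono) auto
  then show ?thesis by (simp add: mult_ac)
qed

lemma cfourier_bound:
  assumes "continuous_on UNIV \<phi>" "\<And>t. \<bar>t\<bar> > A \<Longrightarrow> \<phi> t = 0"
  shows "cmod (cfourier \<phi> w) \<le> (LINT t|lborel. cmod (\<phi> t)) * exp (2 * pi * A * \<bar>Im w\<bar>)"
proof -
  have "cmod (cfourier \<phi> w) \<le> (LINT t|lborel. cmod (\<phi> t) * exp (2 * pi * A * \<bar>Im w\<bar>))"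
    unfolding cfourier_def
  proof (rule Bochner_Integration.integral_norm_bound_integral)
    show "integrable lborel (\<lambda>t. \<phi> t * exp (- (2 * of_real pi * \<i> * w * of_real t)))"
      by (rule integrable_cfourier[of _ A]) (use assms in auto)
    show "integrable lborel (\<lambda>t. cmod (\<phi> t) * exp (2 * pi * A * \<bar>Im w\<bar>))"
      by (intro integrable_mult_left integrable_norm integrable_compact_support[of _ A]) (use assms in auto)
    show "cmod (\<phi> t * exp (- (2 * of_real pi * \<i> * w * of_real t))) \<le> cmod (\<phi> t) * exp (2 * pi * A * \<bar>Im w\<bar>)" for t
      unfolding norm_mult using norm_exp_fourier_le[of t A w] assms(2)[of t]
      by (cases "\<bar>t\<bar> \<le> A") (auto intro!: mult_left_mono)
  qed
  then show ?thesis by simp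
qed

text \<open>Each derivative buys one power of |w|, and the exponential factor survives unchanged
  because differentiation does not enlarge the interval [-A, A].\<close>

lemma cfourier_decay_power:
  assumes "smooth \<phi>" "\<And>t. \<bar>t\<bar> > A \<Longrightarrow> \<phi> t = 0"
  shows "\<exists>C\<ge>0. \<forall>w. cmod w ^ j * cmod (cfourier \<phi> w) \<le> C * exp (2 * pi * A * \<bar>Im w\<bar>)"
  using assms
proof (induction j arbitrary: \<phi>)
  case 0
  show ?case
    using cfourier_bound[OF smooth_continuous_on[OF 0(1)] 0(2)] by (intro exI[of _ "LINT t|lborel. cmod (\<phi> t)"]) auto
next
  case (Suc j)
  have "\<exists>C\<ge>0. \<forall>w. cmod w ^ j * cmod (cfourier (vderiv \<phi>) w) \<le> C * exp (2 * pi * A * \<bar>Im w\<bar>)"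
    by (rule Suc.IH[OF smooth_vderiv[OF Suc.prems(1)]]) (rule vderiv_zero_outside[OF Suc.prems(2)])
  then obtain C where C: "C \<ge> 0" "\<And>w. cmod w ^ j * cmod (cfourier (vderiv \<phi>) w) \<le> C * exp (2 * pi * A * \<bar>Im w\<bar>)"
    by auto
  have "cmod w ^ Suc j * cmod (cfourier \<phi> w) = (cmod w ^ j * cmod (cfourier (vderiv \<phi>) w)) / (2 * pi)" for w
    using cfourier_vderiv[OF Suc.prems, where w = w] by (simp add: norm_mult)
  then have "cmod w ^ Suc j * cmod (cfourier \<phi> w) \<le> (C / (2 * pi)) * exp (2 * pi * A * \<bar>Im w\<bar>)" for w
    using C(2)[of w] by (simp add: divide_right_mono)
  then show ?case using C(1) by (intro exI[of _ "C / (2 * pi)"]) auto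
qed

text \<open>The power |w|^N says nothing near w = 0. The cases j = 0 and j = N of the previous lemma
  are merged through (1 + |w|)^N \<le> 2^N (1 + |w|^N).\<close>

lemma cfourier_decay:
  assumes "smooth \<phi>" "\<And>t. \<bar>t\<bar> > A \<Longrightarrow> \<phi> t = 0"
  obtains C where "C \<ge> 0" "\<And>w. cmod (cfourier \<phi> w) \<le> C * exp (2 * pi * A * \<bar>Im w\<bar>) / (1 + cmod w) ^ N"
proof -
  obtain C0 where C0: "C0 \<ge> 0" "\<And>w. cmod w ^ 0 * cmod (cfourier \<phi> w) \<le> C0 * exp (2 * pi * A * \<bar>Im w\<bar>)"
    using cfourier_decay_power[OF assms, where j = 0] by blast
  obtain C1 where C1: "C1 \<ge> 0" "\<And>w. cmod w ^ N * cmod (cfourier \<phi> w) \<le> C1 * exp (2 * pi * A * \<bar>Im w\<bar>)"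
    using cfourier_decay_power[OF assms, where j = N] by blast
  have "cmod (cfourier \<phi> w) \<le> (2 ^ N * (C0 + C1)) * exp (2 * pi * A * \<bar>Im w\<bar>) / (1 + cmod w) ^ N" for w
  proof -
    have "(1 + cmod w) ^ N \<le> (2 * max 1 (cmod w)) ^ N" by (intro power_mono) auto
    also have "\<dots> \<le> 2 ^ N * (1 + cmod w ^ N)"
      by (auto simp: power_mult_distrib max_def)
    finally have "(1 + cmod w) ^ N * cmod (cfourier \<phi> w) \<le> 2 ^ N * (1 + cmod w ^ N) * cmod (cfourier \<phi> w)"
      by (rule mult_right_mono) auto
    also have "\<dots> = 2 ^ N * (cmod w ^ 0 * cmod (cfourier \<phi> w) + cmod w ^ N * cmod (cfourier \<phi> w))"
      by (simp add: algebra_simps)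
    also have "\<dots> \<le> 2 ^ N * (C0 * exp (2 * pi * A * \<bar>Im w\<bar>) + C1 * exp (2 * pi * A * \<bar>Im w\<bar>))"
      by (intro mult_left_mono add_mono C0 C1) auto
    finally show ?thesis
      by (subst pos_le_divide_eq) (auto simp: algebra_simps add_pos_nonneg)
  qed
  then show ?thesis using C0(1) C1(1) by (intro that[of "2 ^ N * (C0 + C1)"]) auto
qed

lemma cfourier_holomorphic:
  assumes "continuous_on UNIV \<phi>" "\<And>t. \<bar>t\<bar> > A \<Longrightarrow> \<phi> t = 0"
  shows "cfourier \<phi> holomorphic_on UNIV"
proof -
  let ?f = "\<lambda>w t. \<phi> t * exp (- (2 * of_real pi * \<i> * w * of_real t))"
  have eq: "cfourier \<phi> w = integral (cbox (-A) A) (?f w)" for w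
  proof -
    have "set_integrable lborel {-A..A} (?f w)"
      by (intro borel_integrable_atLeastAtMost' continuous_intros continuous_on_subset[OF assms(1)]) auto
    then have "(LINT t:{-A..A}|lborel. ?f w t) = integral {-A..A} (?f w)"
      by (rule set_borel_integral_eq_integral)
    moreover have "(\<lambda>t. indicator {-A..A} t *\<^sub>R ?f w t) = ?f w"
      using assms(2) by (intro indicator_scaleR_eq[of A]) auto
    ultimately show ?thesis by (simp add: cfourier_def set_lebesgue_integral_def)
  qed
  have "(\<lambda>w. integral (cbox (-A) A) (?f w)) holomorphic_on UNIV"
  proof (rule leibniz_rule_holomorphic)
    show "((\<lambda>w. ?f w t) has_field_derivative
      \<phi> t * (- (2 * of_real pi * \<i> * of_real t) * exp (- (2 * of_real pi * \<i> * w * of_real t)))) (at w within UNIV)" for w t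
      by (auto intro!: derivative_eq_intros)
    show "?f w integrable_on cbox (- A) A" for w
      by (intro integrable_continuous continuous_intros continuous_on_subset[OF assms(1)]) auto
    show "continuous_on (UNIV \<times> cbox (- A) A) (\<lambda>(w, t). \<phi> t *
       (- (2 * of_real pi * \<i> * of_real t) * exp (- (2 * of_real pi * \<i> * w * of_real t))))"
      unfolding case_prod_unfold
      by (intro continuous_intros continuous_on_compose2[OF assms(1)]) auto
  qed auto
  then show ?thesis by (simp add: eq[abs_def])
qed

section \<open>Vanishing off the support\<close>

lemma integrable_tempered_mult:
  fixes u v :: "real \<Rightarrow> complex"
  assumes "u \<in> borel_measurable lborel" "v \<in> borel_measurable lborel"
    and "integrable lborel (\<lambda>t. cmod (u t) / (1 + \<bar>t\<bar>) ^ N)"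
    and "\<And>t. cmod (v t) \<le> C / (1 + \<bar>t\<bar>) ^ N"
  shows "integrable lborel (\<lambda>t. u t * v t)"
proof (rule Bochner_Integration.integrable_bound)
  show "integrable lborel (\<lambda>t. C * (cmod (u t) / (1 + \<bar>t\<bar>) ^ N))"
    using assms(3) by (rule integrable_mult_right)
  show "AE t in lborel. cmod (u t * v t) \<le> norm (C * (cmod (u t) / (1 + \<bar>t\<bar>) ^ N))"
  proof (rule AE_I2)
    fix t
    have "cmod (u t * v t) \<le> cmod (u t) * (C / (1 + \<bar>t\<bar>) ^ N)"
      unfolding norm_mult by (intro mult_left_mono assms) auto
    also have "\<dots> = C * (cmod (u t) / (1 + \<bar>t\<bar>) ^ N)" by simp
    also have "\<dots> \<le> norm (C * (cmod (u t) / (1 + \<bar>t\<bar>) ^ N))"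
      unfolding real_norm_def by (rule abs_ge_self)
    finally show "cmod (u t * v t) \<le> norm (C * (cmod (u t) / (1 + \<bar>t\<bar>) ^ N))" .
  qed
  show "(\<lambda>t. u t * v t) \<in> borel_measurable lborel"
    by (rule borel_measurable_times[OF assms(1,2)])
qed

lemma cfourier_measurable:
  assumes "continuous_on UNIV \<phi>" "\<And>t. \<bar>t\<bar> > A \<Longrightarrow> \<phi> t = 0"
  shows "(\<lambda>t. cfourier \<phi> (of_real (a * t + c))) \<in> borel_measurable borel"
proof -
  have "continuous_on UNIV (cfourier \<phi>)"
    by (rule holomorphic_on_imp_continuous_on[OF cfourier_holomorphic[OF assms(1)]]) (erule assms(2))
  then have "continuous_on UNIV (\<lambda>t. cfourier \<phi> (of_real (a * t + c)))"
    by (rule continuous_on_compose2) (auto intro!: continuous_intros)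
  then show ?thesis by (rule borel_measurable_continuous_onI)
qed

lemma fourier_measurable:
  assumes "continuous_on UNIV \<phi>" "\<And>t. \<bar>t\<bar> > A \<Longrightarrow> \<phi> t = 0"
  shows "fourier \<phi> \<in> borel_measurable borel"
proof -
  have "(\<lambda>t. cfourier \<phi> (of_real (1 * t + 0))) \<in> borel_measurable borel"
    by (rule cfourier_measurable[OF assms(1)]) (erule assms(2))
  then show ?thesis by (simp add: fourier_eq_cfourier[abs_def])
qed

text \<open>A Bochner integral of a non-integrable function is 0 by default, so additivity of
  \<open>dist_fourier\<close> rests on this. The transform of a test function decays faster than any
  weight \<open>N\<close> that tames \<open>u\<close>.\<close>

lemma integrable_tempered_fourier:
  assumes u: "tempered_function u" and \<phi>: "smooth \<phi>" "\<And>t. \<bar>t\<bar> > A \<Longrightarrow> \<phi> t = 0"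
  shows "integrable lborel (\<lambda>t. u t * fourier \<phi> t)"
proof -
  obtain N where N: "u \<in> borel_measurable lborel" "integrable lborel (\<lambda>t. cmod (u t) / (1 + \<bar>t\<bar>) ^ N)"
    using u unfolding tempered_function_def by blast
  obtain C where C: "\<And>w. cmod (cfourier \<phi> w) \<le> C * exp (2 * pi * A * \<bar>Im w\<bar>) / (1 + cmod w) ^ N"
    by (rule cfourier_decay[OF \<phi>(1), where A = A and N = N]) (erule \<phi>(2), rule that)
  show ?thesis
  proof (rule integrable_tempered_mult[OF N(1) _ N(2)])
    show "fourier \<phi> \<in> borel_measurable lborel"
      unfolding measurable_lborel2
      by (rule fourier_measurable[OF smooth_continuous_on[OF \<phi>(1)]]) (erule \<phi>(2))
    show "cmod (fourier \<phi> t) \<le> C / (1 + \<bar>t\<bar>) ^ N" for t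
      using C[of "of_real t"] by (simp add: fourier_eq_cfourier)
  qed
qed

lemma fourier_add:
  assumes "continuous_on UNIV \<phi>" "\<And>t. \<bar>t\<bar> > A \<Longrightarrow> \<phi> t = 0"
    and "continuous_on UNIV \<psi>" "\<And>t. \<bar>t\<bar> > A \<Longrightarrow> \<psi> t = 0"
  shows "fourier (\<lambda>t. \<phi> t + \<psi> t) \<omega> = fourier \<phi> \<omega> + fourier \<psi> \<omega>"
proof -
  have "integrable lborel (\<lambda>t. \<phi> t * exp (- (2 * of_real pi * \<i> * of_real \<omega> * of_real t)))"
    by (rule integrable_cfourier[OF assms(1)]) (erule assms(2))
  moreover have "integrable lborel (\<lambda>t. \<psi> t * exp (- (2 * of_real pi * \<i> * of_real \<omega> * of_real t)))"
    by (rule integrable_cfourier[OF assms(3)]) (erule assms(4))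
  ultimately show ?thesis
    unfolding fourier_def distrib_right by (rule Bochner_Integration.integral_add)
qed

lemma dist_fourier_add:
  assumes u: "tempered_function u" and \<phi>: "smooth \<phi>" "\<And>t. \<bar>t\<bar> > A \<Longrightarrow> \<phi> t = 0"
    and \<psi>: "smooth \<psi>" "\<And>t. \<bar>t\<bar> > A \<Longrightarrow> \<psi> t = 0"
  shows "dist_fourier (regular_dist u) (\<lambda>t. \<phi> t + \<psi> t) =
    dist_fourier (regular_dist u) \<phi> + dist_fourier (regular_dist u) \<psi>"
proof -
  have "fourier (\<lambda>t. \<phi> t + \<psi> t) \<omega> = fourier \<phi> \<omega> + fourier \<psi> \<omega>" for \<omega>
    by (rule fourier_add[OF smooth_continuous_on[OF \<phi>(1)] _ smooth_continuous_on[OF \<psi>(1)]])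
      (erule \<phi>(2), erule \<psi>(2))
  moreover have "integrable lborel (\<lambda>t. u t * fourier \<phi> t)"
    by (rule integrable_tempered_fourier[OF u \<phi>(1)]) (erule \<phi>(2))
  moreover have "integrable lborel (\<lambda>t. u t * fourier \<psi> t)"
    by (rule integrable_tempered_fourier[OF u \<psi>(1)]) (erule \<psi>(2))
  ultimately show ?thesis
    by (simp add: dist_fourier_def regular_dist_def distrib_left)
qed

text \<open>A function supported away from \<^term>\<open>{-a..a}\<close> need not be supported in a single
  open set on which the distribution vanishes. It is cut into short pieces by differences of
  translates of a smooth step.\<close>

lemma dist_fourier_vanishes:
  fixes u :: "real \<Rightarrow> complex"
  defines "T \<equiv> dist_fourier (regular_dist u)"
  assumes u: "tempered_function u" and supp: "dist_support T \<subseteq> {-a..a}" and "a < a'"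
    and \<phi>: "smooth \<phi>" "\<And>t. \<bar>t\<bar> > A \<Longrightarrow> \<phi> t = 0" "\<And>t. \<bar>t\<bar> < a' \<Longrightarrow> \<phi> t = 0"
  shows "T \<phi> = 0"
proof -
  define \<G> where "\<G> = {U. open U \<and> (\<forall>\<phi>\<in>test_functions_on U. T \<phi> = 0)}"
  have sub: "tsupp \<phi> \<subseteq> {-A..A} \<inter> - {-a'<..<a'}"
    unfolding tsupp_def
  proof (rule closure_minimal)
    show "{t. \<phi> t \<noteq> 0} \<subseteq> {-A..A} \<inter> - {-a'<..<a'}"
    proof
      fix t assume "t \<in> {t. \<phi> t \<noteq> 0}"
      then have "\<not> \<bar>t\<bar> > A" "\<not> \<bar>t\<bar> < a'" using \<phi>(2,3)[of t] by auto
      then show "t \<in> {-A..A} \<inter> - {-a'<..<a'}" by auto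
    qed
  qed (intro closed_Int closed_atLeastAtMost closed_Compl open_greaterThanLessThan)
  have cpt: "compact (tsupp \<phi>)"
    unfolding compact_eq_bounded_closed
    using bounded_subset[OF bounded_closed_interval, of "tsupp \<phi>" "-A" A] sub by (simp add: tsupp_def)
  have cover: "tsupp \<phi> \<subseteq> \<Union>\<G>"
  proof
    fix x assume that: "x \<in> tsupp \<phi>"
    have "x \<notin> {-a..a}" using that sub \<open>a < a'\<close> by auto
    then have "x \<notin> dist_support T" using supp by blast
    then show "x \<in> \<Union>\<G>" by (simp add: dist_support_def \<G>_def)
  qed
  have opn: "open U" if "U \<in> \<G>" for U using that by (simp add: \<G>_def)
  \<comment> \<open>A Lebesgue number of the cover: every ball of radius \<open>\<epsilon>\<close>
    about a point of the support lies in a single member of \<open>\<G>\<close>.\<close>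
  obtain \<epsilon> where \<epsilon>: "\<epsilon> > 0" "\<And>x. x \<in> tsupp \<phi> \<Longrightarrow> \<exists>U\<in>\<G>. ball x \<epsilon> \<subseteq> U"
    using Heine_Borel_lemma[OF cpt cover opn] by blast
  \<comment> \<open>Two consecutive cutoffs differ only on an interval of length 2
    \<open>\<delta>\<close>. Their difference is therefore supported within 2
    \<open>\<delta>\<close> < \<open>\<epsilon>\<close> of any of its points.\<close>
  define \<delta> where "\<delta> = \<epsilon> / 3"
  have \<delta>: "\<delta> > 0" using \<epsilon> by (simp add: \<delta>_def)
  obtain s where s: "smooth (\<lambda>t. complex_of_real (s t))" "\<And>t. t \<le> 0 \<Longrightarrow> s t = 0" "\<And>t. t \<ge> 1 \<Longrightarrow> s t = 1"
    by (rule smooth_step_exists) blast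
  \<comment> \<open>Raising j by 1 shifts the step to the right by \<open>\<delta>\<close>. The
    offset makes \<open>S 0\<close> equal to 1 from -A onwards, hence on the whole support, and a
    large index makes the step 0 there. As \<open>T\<close> cannot tell consecutive cutoffs apart,
    it gives the same value at both ends.\<close>
  define S where "S j t = complex_of_real (s ((1 / \<delta>) * t + (A / \<delta> + 1 - real j)))" for j :: nat and t
  have smS: "smooth (S j)" for j unfolding S_def by (rule smooth_affine[OF s(1)])
  have step: "T (\<lambda>t. \<phi> t * S j t) = T (\<lambda>t. \<phi> t * S (Suc j) t)" for j
  proof -
    define \<psi> where "\<psi> t = \<phi> t * (S j t - S (Suc j) t)" for t
    have sm: "smooth \<psi>" unfolding \<psi>_def[abs_def] by (intro smooth_mult smooth_diff \<phi> smS)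
    have loc: "\<phi> t \<noteq> 0 \<and> real j < (1 / \<delta>) * t + (A / \<delta> + 1) \<and> (1 / \<delta>) * t + (A / \<delta> + 1) < real j + 2"
      if "\<psi> t \<noteq> 0" for t
    proof -
      define y where "y = (1 / \<delta>) * t + (A / \<delta> + 1 - real j)"
      have y1: "y - 1 = (1 / \<delta>) * t + (A / \<delta> + 1 - real (Suc j))"
        by (simp add: y_def)
      have "S j t = of_real (s y)" "S (Suc j) t = of_real (s (y - 1))"
        by (simp only: S_def y_def) (simp only: S_def y1)
      then have "\<phi> t \<noteq> 0" "s y \<noteq> s (y - 1)" using that unfolding \<psi>_def by auto
      moreover have "\<not> y \<le> 0" using \<open>s y \<noteq> s (y - 1)\<close> s(2)[of y] s(2)[of "y - 1"] by auto
      moreover have "\<not> y \<ge> 2" using \<open>s y \<noteq> s (y - 1)\<close> s(3)[of y] s(3)[of "y - 1"] by auto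
      ultimately show ?thesis unfolding y_def by linarith
    qed
    have "T \<psi> = 0"
    proof (cases "\<exists>t. \<psi> t \<noteq> 0")
      case True
      then obtain t0 where t0: "\<psi> t0 \<noteq> 0" by blast
      then have "t0 \<in> tsupp \<phi>"
        using loc[OF t0] closure_subset[of "{t. \<phi> t \<noteq> 0}"] unfolding tsupp_def by blast
      then obtain U where U: "U \<in> \<G>" "ball t0 \<epsilon> \<subseteq> U" using \<epsilon>(2) by blast
      have "{t. \<psi> t \<noteq> 0} \<subseteq> cball t0 (2 * \<delta>)"
      proof
        fix t assume "t \<in> {t. \<psi> t \<noteq> 0}"
        then have "\<psi> t \<noteq> 0" by simp
        then have "\<bar>(1 / \<delta>) * t - (1 / \<delta>) * t0\<bar> \<le> 2"
          using loc[of t] loc[OF t0] by linarith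
        then have "\<bar>t - t0\<bar> / \<delta> \<le> 2" using \<delta> by (simp add: diff_divide_distrib[symmetric])
        then show "t \<in> cball t0 (2 * \<delta>)" using \<delta> by (simp add: dist_real_def field_simps abs_minus_commute)
      qed
      then have sub0: "tsupp \<psi> \<subseteq> cball t0 (2 * \<delta>)" unfolding tsupp_def by (rule closure_minimal) simp
      also have "\<dots> \<subseteq> ball t0 \<epsilon>" using \<epsilon>(1) by (auto simp: \<delta>_def)
      finally have "tsupp \<psi> \<subseteq> U" using U by blast
      moreover have "compact (tsupp \<psi>)"
        unfolding compact_eq_bounded_closed
        using bounded_subset[OF bounded_cball sub0] by (simp add: tsupp_def)
      ultimately have "\<psi> \<in> test_functions_on U" using sm by (simp add: test_functions_on_def)
      then show ?thesis using U by (auto simp: \<G>_def)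
    next
      case False
      then have "\<psi> = (\<lambda>_. 0)" by auto
      then show ?thesis by (simp add: T_def dist_fourier_def regular_dist_def fourier_def)
    qed
    moreover have "T (\<lambda>t. \<phi> t * S (Suc j) t + \<psi> t) = T (\<lambda>t. \<phi> t * S (Suc j) t) + T \<psi>"
      unfolding T_def
    proof (rule dist_fourier_add[OF u, of _ A])
      show "smooth (\<lambda>t. \<phi> t * S (Suc j) t)" by (intro smooth_mult \<phi> smS)
      show "smooth \<psi>" by (rule sm)
      show "\<phi> t * S (Suc j) t = 0" "\<psi> t = 0" if "\<bar>t\<bar> > A" for t
        using \<phi>(2)[OF that] by (simp_all add: \<psi>_def)
    qed
    moreover have "(\<lambda>t. \<phi> t * S (Suc j) t + \<psi> t) = (\<lambda>t. \<phi> t * S j t)"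
      by (simp add: \<psi>_def algebra_simps)
    ultimately show ?thesis by simp
  qed
  have all: "T (\<lambda>t. \<phi> t * S 0 t) = T (\<lambda>t. \<phi> t * S j t)" for j
  proof (induction j)
    case (Suc j)
    show ?case by (rule trans[OF Suc step])
  qed simp
  obtain M :: nat where M: "2 * \<bar>A\<bar> / \<delta> + 1 \<le> real M" using real_arch_simple by blast
  have in_supp: "-A / \<delta> \<le> t / \<delta> \<and> t / \<delta> \<le> A / \<delta>" if "\<phi> t \<noteq> 0" for t
  proof -
    have "\<bar>t\<bar> \<le> A" using that \<phi>(2)[of t] by linarith
    then have "- A \<le> t" "t \<le> A" by auto
    then show ?thesis using divide_right_mono[of "- A" t \<delta>] divide_right_mono[of t A \<delta>] \<delta> by simp
  qed
  have S0: "\<phi> t * S 0 t = \<phi> t" for t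
  proof (cases "\<phi> t = 0")
    case False
    then have "(1 / \<delta>) * t + (A / \<delta> + 1 - real 0) \<ge> 1" using in_supp[of t] by simp
    then show ?thesis using s(3) by (simp add: S_def)
  qed simp
  have SM: "\<phi> t * S M t = 0" for t
  proof (cases "\<phi> t = 0")
    case False
    have "A / \<delta> \<le> \<bar>A\<bar> / \<delta>" using \<delta> by (intro divide_right_mono) auto
    then have "(1 / \<delta>) * t + (A / \<delta> + 1 - real M) \<le> 0"
      using in_supp[OF False] M by (simp add: add_divide_distrib)
    then have "S M t = of_real 0" unfolding S_def by (intro arg_cong[where f = of_real] s(2))
    then show ?thesis by simp
  next
    case True
    then show ?thesis by simp
  qed
  have S0': "(\<lambda>t. \<phi> t * S 0 t) = \<phi>" by (rule ext) (rule S0)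
  have SM': "(\<lambda>t. \<phi> t * S M t) = (\<lambda>_. 0)" by (rule ext) (rule SM)
  have "T \<phi> = T (\<lambda>_. 0)"
    using all[of M] by (simp only: S0' SM')
  then show ?thesis by (simp add: T_def dist_fourier_def regular_dist_def fourier_def)
qed

section \<open>Approximate identities\<close>

text \<open>As \<open>u\<close> need not be bounded, the integral is split at distance 1 from
  \<open>x\<close>. Near \<open>x\<close>, substituting s = m (t - x) with m = n + 1 allows
  dominated convergence, since \<open>u\<close> is bounded on a compact interval. Far away, N of the
  N + 2 powers of decay absorb the weight of \<open>u\<close>, and the other two turn the factor m
  into 1/m.\<close>

lemma approx_identity:
  fixes u k :: "real \<Rightarrow> complex"
  assumes u: "continuous_on UNIV u" "integrable lborel (\<lambda>t. cmod (u t) / (1 + \<bar>t\<bar>) ^ N)"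
    and k: "continuous_on UNIV k" "integrable lborel k" "\<And>s. cmod (k s) \<le> C / (1 + \<bar>s\<bar>) ^ (N + 2)"
  shows "(\<lambda>n. LINT t|lborel. u t * (of_nat (Suc n) * k (real (Suc n) * (t - x)))) \<longlonglongrightarrow> u x * (LINT s|lborel. k s)"
proof -
  define I where "I = (LINT t|lborel. cmod (u t) / (1 + \<bar>t\<bar>) ^ N)"
  define J where "J = {x - 1..x + 1}"
  define g where "g n t = u t * (of_nat (Suc n) * k (real (Suc n) * (t - x)))" for n t
  have "0 \<le> C" using order_trans[OF norm_ge_zero k(3)[of 0]] by simp
  have [measurable]: "u \<in> borel_measurable borel" "k \<in> borel_measurable borel"
    using u(1) k(1) by (simp_all add: borel_measurable_continuous_onI)
  have J[measurable]: "J \<in> sets borel" by (simp add: J_def)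
  have g_meas[measurable]: "g n \<in> borel_measurable borel" for n unfolding g_def by measurable
  have cont_k: "continuous_on UNIV (\<lambda>t. k (a * (t - x)))" for a
    by (rule continuous_on_compose2[OF k(1)]) (auto intro!: continuous_intros)
  have g_cont: "continuous_on UNIV (g n)" for n
    unfolding g_def by (rule continuous_on_mult[OF u(1) continuous_on_mult[OF continuous_on_const cont_k]])
  have near_int: "integrable lborel (\<lambda>t. indicator J t *\<^sub>R g n t)" for n
    using borel_integrable_atLeastAtMost'[OF continuous_on_subset[OF g_cont[of n] subset_UNIV], of "x - 1" "x + 1"]
    by (simp add: set_integrable_def J_def)
  have far_bound: "cmod (indicator (- J) t *\<^sub>R g n t) \<le>
      C * (2 + \<bar>x\<bar>) ^ N / real (Suc n) * (cmod (u t) / (1 + \<bar>t\<bar>) ^ N)" for n t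
  proof (cases "t \<in> J")
    case True
    then show ?thesis using \<open>0 \<le> C\<close> by simp
  next
    case False
    define m where "m = real (Suc n)"
    define r where "r = \<bar>t - x\<bar>"
    have m: "m \<ge> 1" by (simp add: m_def)
    have r: "r \<ge> 1" using False by (auto simp: J_def r_def)
    have "m\<^sup>2 * r ^ N \<le> (m * r) ^ 2 * (m * r) ^ N"
    proof (intro mult_mono power_mono)
      show "m \<le> m * r" "r \<le> m * r" using m r by simp_all
    qed (use m r in auto)
    also have "\<dots> = (m * r) ^ (N + 2)" by (simp add: power_add power2_eq_square mult_ac)
    also have "\<dots> \<le> (1 + m * r) ^ (N + 2)" using m r by (intro power_mono) auto
    finally have le: "m\<^sup>2 * r ^ N \<le> (1 + m * r) ^ (N + 2)" .
    have "1 + \<bar>t\<bar> \<le> (1 + \<bar>x\<bar>) * 1 + r" by (simp add: r_def)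
    also have "\<dots> \<le> (1 + \<bar>x\<bar>) * r + r" using r by (intro add_mono mult_left_mono) auto
    finally have "1 + \<bar>t\<bar> \<le> (2 + \<bar>x\<bar>) * r" by (simp add: algebra_simps)
    then have "(1 + \<bar>t\<bar>) ^ N \<le> ((2 + \<bar>x\<bar>) * r) ^ N" by (intro power_mono) auto
    then have "(1 + \<bar>t\<bar>) ^ N \<le> (2 + \<bar>x\<bar>) ^ N * r ^ N" by (simp only: power_mult_distrib)
    moreover have "1 / Q \<le> T / P" if "P \<le> T * Q" "P > 0" "Q > 0" for P Q T :: real
      using that by (simp add: field_simps)
    ultimately have le2: "1 / r ^ N \<le> (2 + \<bar>x\<bar>) ^ N / (1 + \<bar>t\<bar>) ^ N"
      using r by (simp add: add_pos_nonneg)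
    have "cmod (k (m * (t - x))) \<le> C / (1 + m * r) ^ (N + 2)"
      using k(3)[of "m * (t - x)"] m by (simp add: abs_mult r_def)
    also have "\<dots> \<le> C / (m\<^sup>2 * r ^ N)"
    proof (rule divide_left_mono[OF le \<open>0 \<le> C\<close>])
      have "0 < 1 + m * r" using m r by (simp add: add_pos_nonneg)
      then show "0 < (1 + m * r) ^ (N + 2) * (m\<^sup>2 * r ^ N)"
        using m r by (intro mult_pos_pos zero_less_power) auto
    qed
    finally have "m * cmod (k (m * (t - x))) \<le> m * (C / (m\<^sup>2 * r ^ N))"
      using m by (intro mult_left_mono) auto
    also have "\<dots> = C / m * (1 / r ^ N)" using m by (simp add: power2_eq_square)
    also have "\<dots> \<le> C / m * ((2 + \<bar>x\<bar>) ^ N / (1 + \<bar>t\<bar>) ^ N)"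
      using le2 \<open>0 \<le> C\<close> m by (intro mult_left_mono) auto
    finally have le3: "m * cmod (k (m * (t - x))) \<le> C / m * ((2 + \<bar>x\<bar>) ^ N / (1 + \<bar>t\<bar>) ^ N)" .
    have "cmod (indicator (- J) t *\<^sub>R g n t) = cmod (g n t)" using False by simp
    also have "\<dots> = cmod (u t) * (m * cmod (k (m * (t - x))))"
      unfolding g_def m_def norm_mult norm_of_nat ..
    also have "\<dots> \<le> cmod (u t) * (C / m * ((2 + \<bar>x\<bar>) ^ N / (1 + \<bar>t\<bar>) ^ N))"
      using le3 by (rule mult_left_mono) simp
    also have "\<dots> = C * (2 + \<bar>x\<bar>) ^ N / m * (cmod (u t) / (1 + \<bar>t\<bar>) ^ N)" by simp
    finally show ?thesis unfolding m_def .
  qed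
  have bound_int: "integrable lborel (\<lambda>t. C * (2 + \<bar>x\<bar>) ^ N / real (Suc n) * (cmod (u t) / (1 + \<bar>t\<bar>) ^ N))" for n
    by (rule integrable_mult_right[OF u(2)])
  have far_int: "integrable lborel (\<lambda>t. indicator (- J) t *\<^sub>R g n t)" for n
  proof (rule Bochner_Integration.integrable_bound[OF bound_int[of n]])
    show "AE t in lborel. cmod (indicator (- J) t *\<^sub>R g n t) \<le>
      norm (C * (2 + \<bar>x\<bar>) ^ N / real (Suc n) * (cmod (u t) / (1 + \<bar>t\<bar>) ^ N))"
      using far_bound[of _ n] unfolding real_norm_def by (intro AE_I2) (rule order_trans[OF _ abs_ge_self])
  qed measurable
  have far_le: "cmod (LINT t|lborel. indicator (- J) t *\<^sub>R g n t) \<le> C * (2 + \<bar>x\<bar>) ^ N * I / real (Suc n)" for n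
  proof -
    have "cmod (LINT t|lborel. indicator (- J) t *\<^sub>R g n t) \<le>
      (LINT t|lborel. C * (2 + \<bar>x\<bar>) ^ N / real (Suc n) * (cmod (u t) / (1 + \<bar>t\<bar>) ^ N))"
      by (rule Bochner_Integration.integral_norm_bound_integral[OF far_int bound_int far_bound])
    also have "\<dots> = C * (2 + \<bar>x\<bar>) ^ N / real (Suc n) * I"
      unfolding I_def by (rule integral_mult_right_zero)
    finally show ?thesis by simp
  qed
  have "(\<lambda>n. C * (2 + \<bar>x\<bar>) ^ N * I / real (Suc n)) \<longlonglongrightarrow> 0"
    by (rule LIMSEQ_Suc[OF lim_const_over_n])
  then have far_lim: "(\<lambda>n. LINT t|lborel. indicator (- J) t *\<^sub>R g n t) \<longlonglongrightarrow> 0"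
    by (rule Lim_null_comparison[OF always_eventually[OF allI[OF far_le]]])
  have near_eq: "(LINT t|lborel. indicator J t *\<^sub>R g n t) =
    (LINT s|lborel. indicator J (x + s / real (Suc n)) *\<^sub>R (u (x + s / real (Suc n)) * k s))" for n
  proof -
    define m where "m = real (Suc n)"
    have m: "m > 0" by (simp add: m_def)
    have "(LINT t|lborel. indicator J t *\<^sub>R g n t) =
      \<bar>1 / m\<bar> *\<^sub>R (LINT s|lborel. indicator J (x + 1 / m * s) *\<^sub>R g n (x + 1 / m * s))"
      by (rule lborel_integral_real_affine) (use m in simp)
    also have "\<dots> = (LINT s|lborel. (1 / m) *\<^sub>R (indicator J (x + 1 / m * s) *\<^sub>R g n (x + 1 / m * s)))"
      unfolding integral_scaleR_right using m by simp
    also have "\<dots> = (LINT s|lborel. indicator J (x + s / m) *\<^sub>R (u (x + s / m) * k s))"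
    proof (rule Bochner_Integration.integral_cong[OF refl])
      fix s
      have "g n (x + 1 / m * s) = of_real m * (u (x + s / m) * k s)"
        using m unfolding g_def m_def[symmetric] by (simp add: m_def)
      then show "(1 / m) *\<^sub>R (indicator J (x + 1 / m * s) *\<^sub>R g n (x + 1 / m * s)) =
        indicator J (x + s / m) *\<^sub>R (u (x + s / m) * k s)"
        using m by (simp add: scaleR_conv_of_real)
    qed
    finally show ?thesis unfolding m_def .
  qed
  have "compact (u ` J)" unfolding J_def
    by (rule compact_continuous_image[OF continuous_on_subset[OF u(1)]]) auto
  then obtain M where M: "\<And>t. t \<in> J \<Longrightarrow> cmod (u t) \<le> M"
    using compact_imp_bounded by (force simp: bounded_iff)
  have "x \<in> J" by (simp add: J_def)
  then have "0 \<le> M" using order_trans[OF norm_ge_zero M[OF \<open>x \<in> J\<close>]] by simp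
  have near_lim: "(\<lambda>n. LINT t|lborel. indicator J t *\<^sub>R g n t) \<longlonglongrightarrow> (LINT s|lborel. u x * k s)"
    unfolding near_eq
  proof (rule integral_dominated_convergence[where w = "\<lambda>s. M * cmod (k s)"])
    show "integrable lborel (\<lambda>s. M * cmod (k s))"
      by (rule integrable_mult_right[OF integrable_norm[OF k(2)]])
    show "AE s in lborel. (\<lambda>n. indicator J (x + s / real (Suc n)) *\<^sub>R (u (x + s / real (Suc n)) * k s))
      \<longlonglongrightarrow> u x * k s"
    proof (rule AE_I2)
      fix s
      have "(\<lambda>n. s / real (Suc n)) \<longlonglongrightarrow> 0"
        by (rule LIMSEQ_Suc[OF lim_const_over_n])
      then have lim: "(\<lambda>n. x + s / real (Suc n)) \<longlonglongrightarrow> x"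
        using tendsto_add[OF tendsto_const, of "\<lambda>n. s / real (Suc n)" 0 sequentially x] by simp
      have "isCont u x" using u(1) by (simp add: continuous_on_eq_continuous_at)
      then have "(\<lambda>n. u (x + s / real (Suc n))) \<longlonglongrightarrow> u x"
        using lim by (rule isCont_tendsto_compose)
      then have "(\<lambda>n. u (x + s / real (Suc n)) * k s) \<longlonglongrightarrow> u x * k s"
        by (rule tendsto_mult_right)
      moreover have "eventually (\<lambda>n. x + s / real (Suc n) \<in> {x - 1<..<x + 1}) sequentially"
        by (rule topological_tendstoD[OF lim]) auto
      then have "eventually (\<lambda>n. u (x + s / real (Suc n)) * k s =
        indicator J (x + s / real (Suc n)) *\<^sub>R (u (x + s / real (Suc n)) * k s)) sequentially"
        by (rule eventually_mono) (auto simp: J_def indicator_def)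
      ultimately show "(\<lambda>n. indicator J (x + s / real (Suc n)) *\<^sub>R (u (x + s / real (Suc n)) * k s)) \<longlonglongrightarrow> u x * k s"
        by (rule Lim_transform_eventually)
    qed
    show "AE s in lborel. cmod (indicator J (x + s / real (Suc n)) *\<^sub>R (u (x + s / real (Suc n)) * k s)) \<le> M * cmod (k s)" for n
    proof (rule AE_I2)
      fix s
      show "cmod (indicator J (x + s / real (Suc n)) *\<^sub>R (u (x + s / real (Suc n)) * k s)) \<le> M * cmod (k s)"
        using M[of "x + s / real (Suc n)"] \<open>0 \<le> M\<close>
        by (cases "x + s / real (Suc n) \<in> J") (simp_all add: norm_mult mult_right_mono)
    qed
  qed measurable
  have split: "g n t = indicator J t *\<^sub>R g n t + indicator (- J) t *\<^sub>R g n t" for n t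
    by (cases "t \<in> J") simp_all
  have "(LINT t|lborel. g n t) = (LINT t|lborel. indicator J t *\<^sub>R g n t) + (LINT t|lborel. indicator (- J) t *\<^sub>R g n t)" for n
    by (subst split, rule Bochner_Integration.integral_add[OF near_int far_int])
  moreover have "(\<lambda>n. (LINT t|lborel. indicator J t *\<^sub>R g n t) + (LINT t|lborel. indicator (- J) t *\<^sub>R g n t))
    \<longlonglongrightarrow> (LINT s|lborel. u x * k s) + 0"
    by (rule tendsto_add[OF near_lim far_lim])
  ultimately show ?thesis unfolding g_def by simp
qed

section \<open>Plateau cutoffs and their dilates\<close>

lemma smooth_plateau_exists:
  fixes a A :: real
  assumes "0 < a" "a < A"
  obtains \<eta> :: "real \<Rightarrow> real" where "smooth (\<lambda>t. complex_of_real (\<eta> t))"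
    "\<And>t. \<bar>t\<bar> > A \<Longrightarrow> \<eta> t = 0" "\<And>t. \<bar>t\<bar> \<le> a \<Longrightarrow> \<eta> t = 1" "\<And>t. 0 \<le> \<eta> t"
proof -
  obtain s where s: "smooth (\<lambda>t. complex_of_real (s t))" "\<And>t. t \<le> 0 \<Longrightarrow> s t = 0"
    "\<And>t. t \<ge> 1 \<Longrightarrow> s t = 1" "\<And>t. 0 \<le> s t"
    by (rule smooth_step_exists) blast
  define c where "c = 1 / (A - a)"
  have c: "c > 0" "c * (A - a) = 1" using assms by (simp_all add: c_def)
  \<comment> \<open>The first factor climbs from 0 to 1 on [-A, -a], the second descends from 1 to 0
    on [a, A]. The slope \<open>c\<close> rescales an interval of length A - a to the unit interval
    of \<open>s\<close>.\<close>
  define \<eta> where "\<eta> t = s (c * t + c * A) * s ((- c) * t + c * A)" for t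
  show ?thesis
  proof (rule that)
    have "smooth (\<lambda>t. complex_of_real (s (c * t + c * A)) * complex_of_real (s ((- c) * t + c * A)))"
      by (rule smooth_mult[OF smooth_affine[OF s(1)] smooth_affine[OF s(1)]])
    then show "smooth (\<lambda>t. complex_of_real (\<eta> t))" by (simp add: \<eta>_def)
    show "0 \<le> \<eta> t" for t unfolding \<eta>_def by (rule mult_nonneg_nonneg[OF s(4) s(4)])
    show "\<eta> t = 0" if "\<bar>t\<bar> > A" for t
    proof -
      have "t + A \<le> 0 \<or> A - t \<le> 0" using that by linarith
      then have "c * (t + A) \<le> 0 \<or> c * (A - t) \<le> 0" using c(1) by (simp add: mult_le_0_iff)
      then have "c * t + c * A \<le> 0 \<or> (- c) * t + c * A \<le> 0" by (simp add: algebra_simps)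
      then have "s (c * t + c * A) = 0 \<or> s ((- c) * t + c * A) = 0" using s(2) by blast
      then show ?thesis unfolding \<eta>_def by (metis mult_zero_left mult_zero_right)
    qed
    show "\<eta> t = 1" if "\<bar>t\<bar> \<le> a" for t
    proof -
      have "c * (A - a) \<le> c * (t + A)" "c * (A - a) \<le> c * (A - t)"
        using that c(1) by (auto intro!: mult_left_mono)
      then have "c * t + c * A \<ge> 1" "(- c) * t + c * A \<ge> 1"
        unfolding c(2) by (simp_all add: algebra_simps)
      from this[THEN s(3)] show ?thesis unfolding \<eta>_def by simp
    qed
  qed
qed

text \<open>Dilation of the cutoff produces the concentrating kernel of
  \<open>approx_identity\<close>, and modulation centres it at \<open>x\<close>.\<close>

lemma fourier_dilate_modulate:
  assumes "m > 0"
  shows "fourier (\<lambda>\<omega>. \<phi> (\<omega> / m) * exp (2 * of_real pi * \<i> * of_real x * of_real \<omega>)) t =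
    of_real m * cfourier \<phi> (of_real (m * (t - x)))"
proof -
  have "fourier (\<lambda>\<omega>. \<phi> (\<omega> / m) * exp (2 * of_real pi * \<i> * of_real x * of_real \<omega>)) t =
    \<bar>m\<bar> *\<^sub>R (LINT \<omega>|lborel. \<phi> ((0 + m * \<omega>) / m) * exp (2 * of_real pi * \<i> * of_real x * of_real (0 + m * \<omega>)) *
      exp (- (2 * of_real pi * \<i> * of_real t * of_real (0 + m * \<omega>))))"
    unfolding fourier_def by (rule lborel_integral_real_affine) (use assms in simp)
  moreover have "\<phi> ((0 + m * \<omega>) / m) * exp (2 * of_real pi * \<i> * of_real x * of_real (0 + m * \<omega>)) *
      exp (- (2 * of_real pi * \<i> * of_real t * of_real (0 + m * \<omega>))) =
      \<phi> \<omega> * exp (- (2 * of_real pi * \<i> * of_real (m * (t - x)) * of_real \<omega>))" for \<omega>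
  proof -
    have "2 * of_real pi * \<i> * of_real x * of_real (0 + m * \<omega>) + - (2 * of_real pi * \<i> * of_real t * of_real (0 + m * \<omega>))
      = - (2 * of_real pi * \<i> * of_real (m * (t - x)) * of_real \<omega>)"
      by (simp add: algebra_simps)
    then show ?thesis using assms by (simp only: mult.assoc exp_add[symmetric]) simp
  qed
  ultimately show ?thesis using assms by (simp only: cfourier_def) (simp add: scaleR_conv_of_real)
qed

section \<open>Testing the approximate identity on a Gaussian\<close>

lemma fourier_std_normal_density:
  "fourier (\<lambda>t. of_real (std_normal_density t)) \<omega> = of_real (exp (- ((2 * pi * \<omega>)\<^sup>2) / 2))"
proof -
  \<comment> \<open>A characteristic function integrates against exp(i s t), so the present
    normalisation corresponds to s = -2 \<pi> \<omega>.\<close>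
  have "of_real (exp (- ((2 * pi * \<omega>)\<^sup>2) / 2)) = char std_normal_distribution (- (2 * pi * \<omega>))"
    by (simp add: char_std_normal_distribution)
  also have "\<dots> = (CLINT t|lborel. std_normal_density t *\<^sub>R iexp (- (2 * pi * \<omega>) * t))"
    unfolding char_def by (rule integral_density) auto
  also have "\<dots> = fourier (\<lambda>t. of_real (std_normal_density t)) \<omega>"
    unfolding fourier_def
    by (intro Bochner_Integration.integral_cong refl) (simp add: scaleR_conv_of_real mult_ac)
  finally show ?thesis ..
qed

text \<open>Fubini for g(t) \<phi>(\<omega>) exp(-2 \<pi> i \<omega> t). It moves the transform from
  the cutoff to the Gaussian, where it is explicit and positive.\<close>

lemma fourier_multiplication_formula:
  assumes g: "integrable lborel g" and \<phi>: "integrable lborel \<phi>"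
  shows "(LINT t|lborel. g t * fourier \<phi> t) = (LINT \<omega>|lborel. fourier g \<omega> * \<phi> \<omega>)"
proof -
  let ?f = "\<lambda>t \<omega>. g t * \<phi> \<omega> * exp (- (2 * of_real pi * \<i> * of_real \<omega> * of_real t))"
  have [measurable]: "g \<in> borel_measurable borel" "\<phi> \<in> borel_measurable borel"
    using borel_measurable_integrable[OF g] borel_measurable_integrable[OF \<phi>] by simp_all
  have norm_f: "cmod (?f t \<omega>) = cmod (g t) * cmod (\<phi> \<omega>)" for t \<omega>
    by (simp add: norm_mult)
  have f_meas: "case_prod ?f \<in> borel_measurable (lborel \<Otimes>\<^sub>M lborel)" by measurable
  have "integrable (lborel \<Otimes>\<^sub>M lborel) (case_prod ?f)"
  proof (rule lborel_pair.Fubini_integrable[OF f_meas])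
    show "integrable lborel (\<lambda>t. LINT \<omega>|lborel. norm (case_prod ?f (t, \<omega>)))"
      using integrable_norm[OF g] by (simp add: norm_f)
    have "integrable lborel (?f t)" for t
    proof (rule Bochner_Integration.integrable_bound)
      show "integrable lborel (\<lambda>\<omega>. g t * \<phi> \<omega>)" using \<phi> by simp
    qed (auto simp: norm_f norm_mult)
    then show "AE t in lborel. integrable lborel (\<lambda>\<omega>. case_prod ?f (t, \<omega>))" by simp
  qed
  then have "(LINT \<omega>|lborel. LINT t|lborel. ?f t \<omega>) = (LINT t|lborel. LINT \<omega>|lborel. ?f t \<omega>)"
    by (rule lborel_pair.Fubini_integral)
  moreover have "(LINT \<omega>|lborel. ?f t \<omega>) = g t * fourier \<phi> t" for t
  proof -
    have "(LINT \<omega>|lborel. ?f t \<omega>) = (LINT \<omega>|lborel. g t * (\<phi> \<omega> * exp (- (2 * of_real pi * \<i> * of_real t * of_real \<omega>))))"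
      by (intro Bochner_Integration.integral_cong refl) (simp add: mult_ac)
    then show ?thesis by (simp add: fourier_def)
  qed
  moreover have "(LINT t|lborel. ?f t \<omega>) = fourier g \<omega> * \<phi> \<omega>" for \<omega>
  proof -
    have "(LINT t|lborel. ?f t \<omega>) = (LINT t|lborel. (g t * exp (- (2 * of_real pi * \<i> * of_real \<omega> * of_real t))) * \<phi> \<omega>)"
      by (intro Bochner_Integration.integral_cong refl) (simp add: mult_ac)
    then show ?thesis by (simp add: fourier_def)
  qed
  ultimately show ?thesis by simp
qed

lemma integrable_fourier_test:
  assumes "smooth \<phi>" "\<And>t. \<bar>t\<bar> > A \<Longrightarrow> \<phi> t = 0"
  shows "integrable lborel (\<lambda>s. cfourier \<phi> (of_real s))"
proof -
  obtain C where C: "C \<ge> 0" "\<And>w. cmod (cfourier \<phi> w) \<le> C * exp (2 * pi * A * \<bar>Im w\<bar>) / (1 + cmod w) ^ 2"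
    by (rule cfourier_decay[OF assms(1), where A = A and N = 2]) (erule assms(2), rule that)
  show ?thesis
  proof (rule Bochner_Integration.integrable_bound)
    have "integrable lborel (\<lambda>s::real. inverse (1 + s\<^sup>2))"
      using integrable_inverse_1_plus_square by (simp add: set_integrable_def)
    then show "integrable lborel (\<lambda>s::real. C * inverse (1 + s\<^sup>2))" by simp
    show "(\<lambda>s. cfourier \<phi> (of_real s)) \<in> borel_measurable lborel"
      using fourier_measurable[OF smooth_continuous_on[OF assms(1)] assms(2)]
      by (simp add: fourier_eq_cfourier[abs_def])
    show "AE s in lborel. norm (cfourier \<phi> (of_real s)) \<le> norm (C * inverse (1 + s\<^sup>2))"
    proof (rule AE_I2)
      fix s :: real
      have "1 + s\<^sup>2 \<le> (1 + \<bar>s\<bar>)\<^sup>2" by (simp add: power2_eq_square algebra_simps)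
      then have "C / (1 + \<bar>s\<bar>)\<^sup>2 \<le> C / (1 + s\<^sup>2)"
        using C(1) by (intro divide_left_mono) (auto intro!: mult_pos_pos add_pos_nonneg)
      then have "cmod (cfourier \<phi> (of_real s)) \<le> C * inverse (1 + s\<^sup>2)"
        using C(2)[of "of_real s"] by (simp add: divide_inverse)
      then show "norm (cfourier \<phi> (of_real s)) \<le> norm (C * inverse (1 + s\<^sup>2))"
        using C(1) by simp
    qed
  qed
qed

lemma cfourier_real_bound:
  assumes "smooth \<phi>" "\<And>t. \<bar>t\<bar> > A \<Longrightarrow> \<phi> t = 0"
  obtains C where "\<And>s. cmod (cfourier \<phi> (of_real s)) \<le> C / (1 + \<bar>s\<bar>) ^ N"
proof -
  obtain C where C: "\<And>w. cmod (cfourier \<phi> w) \<le> C * exp (2 * pi * A * \<bar>Im w\<bar>) / (1 + cmod w) ^ N"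
    by (rule cfourier_decay[OF assms(1), where A = A and N = N]) (erule assms(2), rule that)
  show ?thesis
  proof (rule that)
    show "cmod (cfourier \<phi> (of_real s)) \<le> C / (1 + \<bar>s\<bar>) ^ N" for s
      using C[of "of_real s"] by simp
  qed
qed

lemma continuous_on_cfourier_real:
  assumes "smooth \<phi>" "\<And>t. \<bar>t\<bar> > A \<Longrightarrow> \<phi> t = 0"
  shows "continuous_on UNIV (\<lambda>s. cfourier \<phi> (of_real s))"
proof -
  have "continuous_on UNIV (cfourier \<phi>)"
    by (rule holomorphic_on_imp_continuous_on[OF cfourier_holomorphic[OF smooth_continuous_on[OF assms(1)]]])
      (erule assms(2))
  then show ?thesis
    by (rule continuous_on_compose2) (auto intro!: continuous_intros)
qed

text \<open>By Fourier inversion the integral is \<open>\<eta> 0\<close>, but only that it is nonzero matters: the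
  approximate identity is tested on a Gaussian, whose Fourier transform is positive.\<close>

lemma integral_fourier_plateau_nonzero:
  fixes \<eta> :: "real \<Rightarrow> real"
  assumes "smooth (\<lambda>t. complex_of_real (\<eta> t))" "\<And>t. \<bar>t\<bar> > A \<Longrightarrow> \<eta> t = 0"
    and "\<And>t. \<bar>t\<bar> \<le> a \<Longrightarrow> \<eta> t = 1" "\<And>t. 0 \<le> \<eta> t" "a > 0"
  shows "(LINT s|lborel. cfourier (\<lambda>t. of_real (\<eta> t)) (of_real s)) \<noteq> 0"
proof
  assume zero: "(LINT s|lborel. cfourier (\<lambda>t. of_real (\<eta> t)) (of_real s)) = 0"
  define \<phi> where "\<phi> = (\<lambda>t. complex_of_real (\<eta> t))"
  define G where "G t = complex_of_real (std_normal_density t)" for t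
  \<comment> \<open>The length of [-a, a] times the least value of the Gaussian's transform there.
    It bounds the tested integrals from below for every \<open>n\<close>, whereas a vanishing kernel
    integral would make them tend to 0.\<close>
  define \<delta> where "\<delta> = 2 * a * exp (- ((2 * pi * a)\<^sup>2) / 2)"
  have sm: "smooth \<phi>" unfolding \<phi>_def by (rule assms(1))
  have supp: "\<phi> t = 0" if "\<bar>t\<bar> > A" for t using assms(2)[OF that] by (simp add: \<phi>_def)
  have G_int: "integrable lborel G"
    unfolding G_def[abs_def] by (rule integrable_of_real) (rule integrable_normal_density, simp)
  obtain C where C: "\<And>s. cmod (cfourier \<phi> (of_real s)) \<le> C / (1 + \<bar>s\<bar>) ^ (0 + 2)"
    by (rule cfourier_real_bound[OF sm, where A = A and N = "0 + 2"]) (erule supp, rule that)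
  have "(\<lambda>n. LINT t|lborel. G t * (of_nat (Suc n) * cfourier \<phi> (of_real (real (Suc n) * (t - 0)))))
    \<longlonglongrightarrow> G 0 * (LINT s|lborel. cfourier \<phi> (of_real s))"
  proof (rule approx_identity[where N = 0 and C = C])
    show "continuous_on UNIV G"
      unfolding G_def[abs_def] std_normal_density_def[abs_def] by (auto intro!: continuous_intros)
    show "integrable lborel (\<lambda>t. cmod (G t) / (1 + \<bar>t\<bar>) ^ 0)" using integrable_norm[OF G_int] by simp
    show "continuous_on UNIV (\<lambda>s. cfourier \<phi> (of_real s))"
      by (rule continuous_on_cfourier_real[OF sm]) (erule supp)
    show "integrable lborel (\<lambda>s. cfourier \<phi> (of_real s))"
      by (rule integrable_fourier_test[OF sm]) (erule supp)
  qed (rule C)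
  then have lim: "(\<lambda>n. LINT t|lborel. G t * (of_nat (Suc n) * cfourier \<phi> (of_real (real (Suc n) * (t - 0))))) \<longlonglongrightarrow> 0"
    using zero by (simp add: \<phi>_def)
  have "\<delta> \<le> cmod (LINT t|lborel. G t * (of_nat (Suc n) * cfourier \<phi> (of_real (real (Suc n) * (t - 0)))))" for n
  proof -
    define m where "m = real (Suc n)"
    have m: "m \<ge> 1" by (simp add: m_def)
    define \<psi> where "\<psi> \<omega> = \<phi> (\<omega> / m)" for \<omega>
    have four: "fourier \<psi> t = of_real m * cfourier \<phi> (of_real (m * (t - 0)))" for t
      using fourier_dilate_modulate[of m \<phi> 0 t] m by (simp add: \<psi>_def[abs_def])
    define h where "h \<omega> = exp (- ((2 * pi * \<omega>)\<^sup>2) / 2) * \<eta> (\<omega> / m)" for \<omega>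
    have \<psi>_smooth: "smooth \<psi>"
      using smooth_affine[OF sm, of "1 / m" 0] by (simp add: \<psi>_def[abs_def])
    have \<psi>_supp: "\<psi> t = 0" if "\<bar>t\<bar> > m * A" for t
    proof -
      have "\<bar>t / m\<bar> > A" using that m by (simp add: pos_less_divide_eq mult.commute)
      then show ?thesis unfolding \<psi>_def by (rule supp)
    qed
    have \<psi>_int: "integrable lborel \<psi>"
      by (rule integrable_compact_support[OF smooth_continuous_on[OF \<psi>_smooth]]) (erule \<psi>_supp)
    have "(LINT t|lborel. G t * (of_nat (Suc n) * cfourier \<phi> (of_real (real (Suc n) * (t - 0)))))
      = (LINT t|lborel. G t * fourier \<psi> t)"
      unfolding four m_def by simp
    also have "\<dots> = (LINT \<omega>|lborel. fourier G \<omega> * \<psi> \<omega>)"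
      by (rule fourier_multiplication_formula[OF G_int \<psi>_int])
    also have "\<dots> = (LINT \<omega>|lborel. complex_of_real (h \<omega>))"
      unfolding G_def[abs_def] fourier_std_normal_density h_def \<psi>_def \<phi>_def by simp
    also have "\<dots> = complex_of_real (LINT \<omega>|lborel. h \<omega>)" by (rule integral_complex_of_real)
    finally have eq: "(LINT t|lborel. G t * (of_nat (Suc n) * cfourier \<phi> (of_real (real (Suc n) * (t - 0)))))
      = complex_of_real (LINT \<omega>|lborel. h \<omega>)" .
    have h_int: "integrable lborel h"
    proof -
      have "integrable lborel (\<lambda>\<omega>. exp (- ((2 * of_real pi * of_real \<omega>)\<^sup>2) / 2) * \<psi> \<omega>)"
      proof (rule integrable_compact_support)
        show "continuous_on UNIV (\<lambda>\<omega>. exp (- ((2 * of_real pi * of_real \<omega>)\<^sup>2) / 2) * \<psi> \<omega>)"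
          by (rule continuous_on_mult[OF _ smooth_continuous_on[OF \<psi>_smooth]]) (auto intro!: continuous_intros)
        show "exp (- ((2 * of_real pi * of_real t)\<^sup>2) / 2) * \<psi> t = 0" if "\<bar>t\<bar> > m * A" for t
          using \<psi>_supp[OF that] by simp
      qed
      moreover have "exp (- ((2 * of_real pi * of_real \<omega>)\<^sup>2) / 2) * \<psi> \<omega> = complex_of_real (h \<omega>)" for \<omega>
        by (simp add: h_def \<psi>_def \<phi>_def exp_of_real[symmetric])
      ultimately show ?thesis by (simp add: complex_of_real_integrable_eq)
    qed
    have "\<delta> = (LINT \<omega>|lborel. indicator {-a..a} \<omega> * exp (- ((2 * pi * a)\<^sup>2) / 2))"
      using assms(5) by (simp add: \<delta>_def)
    also have "\<dots> \<le> (LINT \<omega>|lborel. h \<omega>)"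
    proof (rule integral_mono[OF _ h_int])
      show "integrable lborel (\<lambda>\<omega>. indicator {-a..a} \<omega> * exp (- ((2 * pi * a)\<^sup>2) / 2))"
        by (rule integrable_mult_left) (rule integrable_real_indicator, simp, use assms(5) in simp)
      show "indicator {-a..a} \<omega> * exp (- ((2 * pi * a)\<^sup>2) / 2) \<le> h \<omega>" for \<omega>
      proof (cases "\<bar>\<omega>\<bar> \<le> a")
        case True
        \<comment> \<open>Since m \<ge> 1, dilation only widens the plateau: it still covers
          [-a, a].\<close>
        have "\<bar>\<omega> / m\<bar> \<le> \<bar>\<omega>\<bar>" using m by (simp add: divide_le_eq mult_left_le_one_le mult_le_cancel_left1)
        then have "\<eta> (\<omega> / m) = 1" using True by (intro assms(3)) linarith
        moreover have "\<omega>\<^sup>2 \<le> a\<^sup>2" using True assms(5) by (simp add: abs_le_square_iff[symmetric])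
        then have "(2 * pi * \<omega>)\<^sup>2 \<le> (2 * pi * a)\<^sup>2" by (simp add: power_mult_distrib)
        moreover have "\<omega> \<in> {-a..a}" using True by auto
        ultimately show ?thesis by (simp add: h_def)
      next
        case False
        then have "\<omega> \<notin> {-a..a}" by auto
        then show ?thesis using assms(4) by (simp add: h_def)
      qed
    qed
    finally show ?thesis unfolding eq using order_trans[OF _ abs_ge_self] by simp
  qed
  then have "\<delta> \<le> cmod 0"
    by (intro LIMSEQ_le_const[OF tendsto_norm[OF lim]]) blast
  then show False using assms(5) by (simp add: \<delta>_def mult_le_0_iff)
qed

section \<open>A Jensen inequality without integrals\<close>

text \<open>The m terms of the half sum \<open>S\<close> cover one period \<pi> of |sin|, so a shift
  by \<pi>/m permutes them cyclically. This reduces \<open>\<theta>\<close> to [0, \<pi>/m], where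
  every sine is nonnegative and the absolute values drop.\<close>

lemma sum_abs_sin_le:
  fixes \<theta> :: real
  assumes "m \<ge> 1" "\<theta> \<ge> 0"
  shows "(\<Sum>j<2 * m. \<bar>sin (\<theta> + pi * real j / real m)\<bar>) \<le> 2 / sin (pi / (2 * real m))"
proof -
  define S where "S t = (\<Sum>j<m. \<bar>sin (t + pi * real j / real m)\<bar>)" for t
  have m: "real m > 0" "m > 0" using assms by auto
  have abs_sin: "\<bar>sin (t + pi)\<bar> = \<bar>sin t\<bar>" for t :: real by simp
  have shift1: "S (t + pi / real m) = S t" for t
  proof -
    have "S (t + pi / real m) = (\<Sum>j<m. \<bar>sin (t + pi * real (Suc j) / real m)\<bar>)"
      unfolding S_def by (intro sum.cong refl arg_cong[where f = abs] arg_cong[where f = sin])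
        (simp add: field_simps)
    also have "\<dots> = (\<Sum>j<Suc m. \<bar>sin (t + pi * real j / real m)\<bar>) - \<bar>sin t\<bar>"
      by (subst sum.lessThan_Suc_shift) simp
    also have "\<dots> = S t" using m abs_sin[of t] by (simp add: S_def)
    finally show ?thesis .
  qed
  have shift: "S (t + real n * (pi / real m)) = S t" for t n
  proof (induction n)
    case (Suc n)
    have "t + real (Suc n) * (pi / real m) = t + real n * (pi / real m) + pi / real m"
      by (simp only: of_nat_Suc distrib_right mult_1 add.assoc add.commute[of "pi / real m"])
    then have "S (t + real (Suc n) * (pi / real m)) = S (t + real n * (pi / real m) + pi / real m)"
      by (rule arg_cong)
    then show ?case using shift1 Suc by simp
  qed simp
  have base: "S t \<le> 1 / sin (pi / (2 * real m))" if t: "0 \<le> t" "t \<le> pi / real m" for t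
  proof -
    define h where "h = pi / (2 * real m)"
    have "h > 0" using m by (simp add: h_def)
    have "h \<le> pi / 2" unfolding h_def using assms(1) by (intro divide_left_mono) auto
    then have sh: "sin h > 0" using \<open>h > 0\<close> pi_gt_zero by (intro sin_gt_zero) linarith+
    have pm: "pi * real j / real m = 2 * real j * h" for j by (simp add: h_def)
    have "S t = (\<Sum>j<m. sin (t + 2 * real j * h))"
      unfolding S_def pm
    proof (intro sum.cong refl abs_of_nonneg sin_ge_zero)
      fix j assume "j \<in> {..<m}"
      then have "real j + 1 \<le> real m" by auto
      then have "2 * (real j + 1) * h \<le> 2 * real m * h" using \<open>h > 0\<close> by simp
      also have "\<dots> = pi" using m by (simp add: h_def)
      finally have "2 * real j * h + 2 * h \<le> pi" by (simp add: algebra_simps)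
      moreover have "pi / real m = 2 * h" by (simp add: h_def)
      ultimately show "t + 2 * real j * h \<le> pi" using t by linarith
      show "0 \<le> t + 2 * real j * h" using t \<open>h > 0\<close> by simp
    qed
    \<comment> \<open>By 2 sin h sin y = cos(y - h) - cos(y + h), with arguments 2h apart, the sum
      telescopes to a difference of two cosines.\<close>
    then have "2 * sin h * S t = (\<Sum>j<m. cos (t + 2 * real j * h - h) - cos (t + 2 * real (Suc j) * h - h))"
      by (simp add: sum_distrib_left cos_diff_cos algebra_simps add_divide_distrib)
    also have "\<dots> = cos (t - h) - cos (t + 2 * real m * h - h)"
      by (subst sum_lessThan_telescope') simp
    also have "\<dots> \<le> 2"
      using cos_le_one[of "t - h"] cos_ge_minus_one[of "t + 2 * real m * h - h"] by linarith
    finally show ?thesis using sh unfolding h_def by (simp add: field_simps)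
  qed
  \<comment> \<open>The number of whole shifts by \<pi>/m contained in
    \<open>\<theta>\<close>.\<close>
  define n where "n = nat \<lfloor>\<theta> * real m / pi\<rfloor>"
  have fl: "real n = of_int \<lfloor>\<theta> * real m / pi\<rfloor>" using assms by (simp add: n_def)
  have "S \<theta> \<le> 1 / sin (pi / (2 * real m))"
  proof -
    have "real n \<le> \<theta> * real m / pi" "\<theta> * real m / pi \<le> real n + 1" unfolding fl by linarith+
    then have "real n * pi \<le> \<theta> * real m" "\<theta> * real m \<le> (real n + 1) * pi"
      by (simp_all only: pos_le_divide_eq[OF pi_gt_zero] pos_divide_le_eq[OF pi_gt_zero])
    then have "real n * pi / real m \<le> \<theta>" "\<theta> \<le> (real n + 1) * pi / real m"
      by (simp_all only: pos_le_divide_eq[OF m(1)] pos_divide_le_eq[OF m(1)])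
    then have "0 \<le> \<theta> - real n * (pi / real m)" "\<theta> - real n * (pi / real m) \<le> pi / real m"
      by (simp_all add: distrib_right add_divide_distrib del: le_diff_eq diff_le_eq)
    then have "S (\<theta> - real n * (pi / real m)) \<le> 1 / sin (pi / (2 * real m))" by (rule base)
    then show ?thesis using shift[of "\<theta> - real n * (pi / real m)" n] by simp
  qed
  moreover have "(\<Sum>j<2 * m. \<bar>sin (\<theta> + pi * real j / real m)\<bar>) = 2 * S \<theta>"
  proof -
    have split: "(\<Sum>j<m + k. g j) = (\<Sum>j<m. g j) + (\<Sum>j<k. g (m + j))" for g :: "nat \<Rightarrow> real" and k
      by (induction k) auto
    have "\<bar>sin (\<theta> + pi * real (m + j) / real m)\<bar> = \<bar>sin (\<theta> + pi * real j / real m)\<bar>" for j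
    proof -
      have "\<theta> + pi * real (m + j) / real m = (\<theta> + pi * real j / real m) + pi"
        using m by (simp add: field_simps)
      then show ?thesis by (metis abs_sin)
    qed
    then show ?thesis
      unfolding mult_2 split S_def by (simp only:)
  qed
  ultimately show ?thesis by simp
qed

text \<open>The maximum principle is applied to the product of the rotations of \<^term>\<open>P\<close>
  by the \<open>2m\<close>-th roots of unity. As \<open>m\<close> grows, \<open>1 / (m sin (\<pi>/(2m)))\<close> tends to
  \<open>2/\<pi>\<close>, the mean of \<open>\<bar>sin\<bar>\<close>.\<close>

lemma norm_at_0_le_rotation:
  fixes m :: nat
  assumes P: "P holomorphic_on UNIV" and "R > 0" "m \<ge> 1" "\<tau> \<ge> 0"
    and bound: "\<And>z. cmod z = R \<Longrightarrow> cmod (P z) \<le> B * exp (\<tau> * \<bar>Im z\<bar>)"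
  shows "cmod (P 0) \<le> B * exp (\<tau> * R / (m * sin (pi / (2 * m))))"
proof -
  define Q where "Q z = (\<Prod>j<2 * m. P (z * cis (pi * j / m)))" for z
  define E where "E = B * exp (\<tau> * R / (m * sin (pi / (2 * m))))"
  \<comment> \<open>At the real point z = R the exponential factor is 1, so \<open>bound\<close>
    itself forces B \<ge> 0.\<close>
  have "0 \<le> cmod (P (of_real R))" by simp
  also have "\<dots> \<le> B" using bound[of "of_real R"] \<open>R > 0\<close> by simp
  finally have "B \<ge> 0" .
  then have "E \<ge> 0" by (simp add: E_def)
  have holo: "Q holomorphic_on UNIV"
    unfolding Q_def
    by (intro holomorphic_on_prod holomorphic_on_compose_gen[OF _ P, unfolded o_def] holomorphic_intros) auto
  have "cmod (Q 0) \<le> E ^ (2 * m)"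
  proof (rule maximum_modulus_frontier[of Q "cball 0 R"])
    fix z :: complex assume "z \<in> frontier (cball 0 R)"
    then have z: "cmod z = R" using \<open>R > 0\<close> by simp
    have zp: "z = of_real R * cis (Arg2pi z)"
      using Arg2pi_eq[of z] z by (simp add: cis_conv_exp mult.commute)
    have "cmod (Q z) = (\<Prod>j<2 * m. cmod (P (z * cis (pi * j / m))))"
      unfolding Q_def by (rule prod_norm[symmetric])
    also have "\<dots> \<le> (\<Prod>j<2 * m. B * exp (\<tau> * R * \<bar>sin (Arg2pi z + pi * j / m)\<bar>))"
    proof (intro prod_mono conjI norm_ge_zero)
      fix j
      have "Im (z * cis (pi * j / m)) = R * sin (Arg2pi z + pi * j / m)"
        by (subst zp) (simp add: cis_mult mult.assoc)
      then show "cmod (P (z * cis (pi * j / m))) \<le> B * exp (\<tau> * R * \<bar>sin (Arg2pi z + pi * j / m)\<bar>)"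
        using bound[of "z * cis (pi * j / m)"] z \<open>R > 0\<close> by (simp add: norm_mult abs_mult mult.assoc)
    qed
    also have "\<dots> = B ^ (2 * m) * exp (\<tau> * R * (\<Sum>j<2 * m. \<bar>sin (Arg2pi z + pi * j / m)\<bar>))"
      by (simp add: prod.distrib exp_sum sum_distrib_left)
    also have "\<dots> \<le> B ^ (2 * m) * exp (\<tau> * R * (2 / sin (pi / (2 * m))))"
      using sum_abs_sin_le[OF \<open>m \<ge> 1\<close> Arg2pi_ge_0[of z]] \<open>B \<ge> 0\<close> \<open>\<tau> \<ge> 0\<close> \<open>R > 0\<close>
      by (intro mult_left_mono iffD2[OF exp_le_cancel_iff]) auto
    \<comment> \<open>2 / sin is 2m times 1 / (m sin). As all 2m factors of \<open>Q 0\<close> equal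
      \<open>P 0\<close>, a 2m-th root finishes the proof.\<close>
    also have "\<dots> = E ^ (2 * m)"
      using \<open>m \<ge> 1\<close> by (simp add: E_def power_mult_distrib exp_of_nat_mult[symmetric])
    finally show "cmod (Q z) \<le> E ^ (2 * m)" .
  qed (use holo \<open>R > 0\<close> in \<open>auto intro: holomorphic_on_subset holomorphic_on_imp_continuous_on\<close>)
  also have "cmod (Q 0) = cmod (P 0) ^ (2 * m)"
    by (simp add: Q_def norm_power)
  finally show ?thesis
    unfolding E_def[symmetric] using \<open>m \<ge> 1\<close> \<open>E \<ge> 0\<close> by (simp add: power_mono_iff)
qed

text \<open>Each zero x is removed by the reciprocal Blaschke factor (R^2 - cnj(x) z) / (R (z - x)),
  which has modulus 1 on the circle |z| = R and modulus R/|x| at the origin. So the zeros enlarge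
  the value at 0 at no cost on the circle, which is the mechanism of Jensen's formula.\<close>

lemma divide_out_zeros:
  assumes "finite S" "h holomorphic_on UNIV" "R > 0"
    and "\<And>x. x \<in> S \<Longrightarrow> h x = 0 \<and> x \<noteq> 0 \<and> cmod x < R"
  shows "\<exists>P. P holomorphic_on UNIV \<and> (\<forall>z. cmod z = R \<longrightarrow> cmod (P z) \<le> cmod (h z)) \<and>
    cmod (P 0) = cmod (h 0) * (\<Prod>x\<in>S. R / cmod x)"
  using assms
proof (induction S arbitrary: h rule: finite_induct)
  case empty
  then show ?case by auto
next
  case (insert x S)
  \<comment> \<open>The value \<open>deriv h x\<close> fills the removable singularity left by the
    division.\<close>
  define h1 where "h1 z = (if z = x then deriv h x else h z / (z - x))" for z
  define h2 where "h2 z = h1 z * ((of_real (R\<^sup>2) - cnj x * z) / of_real R)" for z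
  have x: "h x = 0" "x \<noteq> 0" using insert.prems by auto
  have "(\<lambda>z. if z = x then deriv h x else h z / (z - x) - h x / (z - x)) holomorphic_on UNIV"
    by (rule pole_theorem_open) (use insert.prems in auto)
  then have "h1 holomorphic_on UNIV" unfolding h1_def using x by (simp cong: if_cong)
  then have "h2 holomorphic_on UNIV" unfolding h2_def
    by (intro holomorphic_intros) (use \<open>R > 0\<close> in auto)
  moreover have "h2 y = 0 \<and> y \<noteq> 0 \<and> cmod y < R" if "y \<in> S" for y
    using insert.prems(3)[of y] insert.hyps that by (auto simp: h2_def h1_def)
  ultimately obtain P where P: "P holomorphic_on UNIV" "\<And>z. cmod z = R \<Longrightarrow> cmod (P z) \<le> cmod (h2 z)"
    "cmod (P 0) = cmod (h2 0) * (\<Prod>x\<in>S. R / cmod x)"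
    using insert.IH[of h2] \<open>R > 0\<close> by blast
  have "cmod (h2 z) = cmod (h z)" if z: "cmod z = R" for z
  proof -
    have "z \<noteq> x" using insert.prems(3)[of x] z by auto
    \<comment> \<open>On the circle R^2 is z times its conjugate.\<close>
    have "of_real (R\<^sup>2) - cnj x * z = z * cnj (z - x)"
      using complex_norm_square[of z] z by (simp add: algebra_simps)
    then have "cmod (of_real (R\<^sup>2) - cnj x * z) = R * cmod (z - x)"
      using z by (metis complex_mod_cnj norm_mult)
    then show ?thesis
      using \<open>z \<noteq> x\<close> \<open>R > 0\<close> by (simp add: h2_def h1_def norm_mult norm_divide)
  qed
  moreover have "cmod (h2 0) = cmod (h 0) * (R / cmod x)"
    using x \<open>R > 0\<close> by (simp add: h2_def h1_def norm_mult norm_divide norm_power power2_eq_square)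
  ultimately show ?case
    using P insert.hyps by (intro exI[of _ P]) (simp add: mult_ac)
qed

text \<open>A weak Stirling bound, e n (n/e)^n. The induction step is n^(n+1) e \<le> (n+1)^(n+1),
  which is ln y \<le> y - 1 at y = n/(n+1).\<close>

lemma fact_le_exp_bound: "n \<ge> 1 \<Longrightarrow> fact n \<le> real n * exp (1 - real n) * real n ^ n"
proof (induction n rule: nat_induct_at_least)
  case base
  show ?case by simp
next
  case (Suc n)
  have n: "real n > 0" using Suc by simp
  have key: "real n ^ Suc n * exp 1 \<le> real (Suc n) ^ Suc n"
  proof -
    have "ln (real n / (real n + 1)) \<le> real n / (real n + 1) - 1"
      using n by (intro ln_le_minus_one) auto
    also have "\<dots> = - (1 / (real n + 1))" using n by (simp add: field_simps)
    finally have "1 \<le> (real n + 1) * (ln (real n + 1) - ln (real n))"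
      using n by (simp add: ln_div field_simps)
    then have "exp 1 \<le> exp (real (Suc n) * (ln (real n + 1) - ln (real n)))" by (simp add: add.commute)
    also have "\<dots> = ((real n + 1) / real n) ^ Suc n"
      using n by (simp only: exp_of_nat_mult exp_diff) simp
    finally show ?thesis using n by (simp add: power_divide field_simps)
  qed
  have "fact (Suc n) \<le> real (Suc n) * (real n * exp (1 - real n) * real n ^ n)"
    using Suc.IH by (simp add: mult_left_mono)
  also have "\<dots> = real (Suc n) * exp (- real n) * (real n ^ Suc n * exp 1)"
    by (simp add: exp_diff exp_minus field_simps)
  also have "\<dots> \<le> real (Suc n) * exp (- real n) * real (Suc n) ^ Suc n"
    using key by (intro mult_left_mono) auto
  finally show ?case by simp
qed

text \<open>The product is L^n m! / L!, with m! \<ge> 1 and the factorial bound applied to L!. It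
  bounds from below the gain from the zeros on one half-line: exp(L) up to a power of L.\<close>

lemma prod_quotient_ge:
  fixes m n :: nat
  assumes "n + m \<ge> 1"
  defines "L \<equiv> real (n + m)"
  shows "exp (L - 1) / L ^ (m + 1) \<le> (\<Prod>i=1..n. L / real (i + m))"
proof -
  have L: "L > 0" using assms by simp
  have f: "fact m * (\<Prod>i=1..k. real (i + m)) = fact (k + m)" for k
  proof (induction k)
    case (Suc k)
    have "fact m * (\<Prod>i=1..Suc k. real (i + m)) = fact m * (\<Prod>i=1..k. real (i + m)) * real (Suc k + m)"
      by (simp add: prod.nat_ivl_Suc')
    then show ?case unfolding Suc.IH by simp
  qed simp
  have "(\<Prod>i=1..n. real (i + m)) \<le> fact m * (\<Prod>i=1..n. real (i + m))"
    using mult_right_mono[OF fact_ge_1[of m, where 'a = real], of "\<Prod>i=1..n. real (i + m)"]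
    by (simp add: prod_nonneg)
  also have "\<dots> \<le> L * exp (1 - L) * L ^ (n + m)"
    unfolding f L_def by (rule fact_le_exp_bound) fact
  finally have le: "(\<Prod>i=1..n. real (i + m)) \<le> L * exp (1 - L) * L ^ (n + m)" .
  have pos: "(\<Prod>i=1..n. real (i + m)) > 0" by (intro prod_pos) auto
  have "exp (L - 1) / L ^ (m + 1) = L ^ n / (L * exp (1 - L) * L ^ (n + m))"
    using L by (simp add: power_add exp_diff field_simps)
  also have "\<dots> \<le> L ^ n / (\<Prod>i=1..n. real (i + m))"
    using le pos L by (intro divide_left_mono mult_pos_pos) auto
  also have "\<dots> = (\<Prod>i=1..n. L / real (i + m))" by (simp add: prod_dividef)
  finally show ?thesis .
qed

text \<open>On the circle of radius R = L/d the zeros on the two half-lines push |P 0| up to |h 0|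
  exp(2L) over a power of L, while the growth allows at most exp(\<sigma> L) times a power of L.
  With \<sigma> < 2 this is impossible for large L unless h 0 = 0.\<close>

lemma no_zero_at_0_of_growth:
  fixes x :: "int \<Rightarrow> real"
  assumes h: "h holomorphic_on UNIV"
    and growth: "\<And>z. cmod (h z) \<le> C * (1 + cmod z) ^ N * exp (\<tau> * \<bar>Im z\<bar>)"
    and x: "inj x" "\<And>k. \<bar>x k - of_int k / d\<bar> \<le> A" "\<And>k. h (of_real (x k)) = 0"
    and d: "d > 0" "0 \<le> \<tau>" "\<tau> < pi * d"
  shows "h 0 = 0"
proof (rule ccontr)
  assume h0: "h 0 \<noteq> 0"
  have "C \<ge> 0" using order_trans[OF norm_ge_zero growth[of 0]] by simp
  obtain m :: nat where m: "m \<ge> 1" "(\<tau> / d) / (real m * sin (pi / (2 * real m))) < 2"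
  proof -
    \<comment> \<open>The limit rate is 2 \<tau> / (\<pi> d), and it lies below 2 precisely because
      \<tau> < \<pi> d. Some finite number of rotations is therefore already enough.\<close>
    have "(\<lambda>m::nat. real m * sin (pi / (2 * real m))) \<longlonglongrightarrow> pi / 2"
      by real_asymp
    then have "(\<lambda>m::nat. (\<tau> / d) / (real m * sin (pi / (2 * real m)))) \<longlonglongrightarrow> (\<tau> / d) / (pi / 2)"
      by (intro tendsto_intros) auto
    moreover have "(\<tau> / d) / (pi / 2) < 2" using d by (simp add: field_simps)
    ultimately have "eventually (\<lambda>m::nat. (\<tau> / d) / (real m * sin (pi / (2 * real m))) < 2) at_top"
      by (rule order_tendstoD(2))
    then have "eventually (\<lambda>m::nat. (\<tau> / d) / (real m * sin (pi / (2 * real m))) < 2 \<and> 1 \<le> m) at_top"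
      by (rule eventually_conj) (rule eventually_ge_at_top)
    then show ?thesis using that eventually_happens'[OF sequentially_bot] by blast
  qed
  define \<sigma> where "\<sigma> = (\<tau> / d) / (real m * sin (pi / (2 * real m)))"
  have \<sigma>: "\<sigma> < 2" using m by (simp add: \<sigma>_def)
  \<comment> \<open>\<open>q\<close> absorbs the deviation \<open>A\<close> in units of the spacing
    1/d. The extra 1 leaves a margin 1/d, which places the chosen zeros strictly inside the
    circle.\<close>
  obtain q :: nat where q: "q \<ge> 1" "A * d + 1 \<le> q"
    by (metis linorder_linear max.bounded_iff of_nat_le_iff real_arch_simple order_trans)
  have bnd: "cmod (h 0) * (exp (L - 1) / L ^ (q + 1)) ^ 2 \<le> C * (1 + L / d) ^ N * exp (\<sigma> * L)"
    if n: "L = real (n + q)" for L n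
  proof -
    define R where "R = L / d"
    have L: "L > 0" using n q by simp
    have R: "R > 0" using L d by (simp add: R_def)
    have small: "\<bar>x k\<bar> \<le> (\<bar>real_of_int k\<bar> + real q) / d - 1 / d" for k
    proof -
      have "\<bar>x k\<bar> \<le> \<bar>of_int k\<bar> / d + A"
        using x(2)[of k] d abs_triangle_ineq2[of "x k" "of_int k / d"] by (simp add: abs_divide)
      also have "A \<le> (real q - 1) / d" using q d by (simp add: field_simps)
      finally show ?thesis by (simp add: add_divide_distrib diff_divide_distrib)
    qed
    have nz: "x k \<noteq> 0" for k using x(3)[of k] h0 by auto
    \<comment> \<open>Index 0 is left out, so that each half-line is indexed by 1..n and
      \<open>prod_quotient_ge\<close> serves both.\<close>
    define I where "I = int ` {1..n}"
    define J where "J = (\<lambda>i. - int i) ` {1..n}"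
    define S where "S = (\<lambda>k. complex_of_real (x k)) ` (I \<union> J)"
    have inj: "inj_on (\<lambda>k. complex_of_real (x k)) (I \<union> J)"
      using x(1) by (auto simp: inj_on_def)
    have IJ: "\<bar>k\<bar> \<le> int n" if "k \<in> I \<union> J" for k using that by (auto simp: I_def J_def)
    have "\<bar>x k\<bar> < R" if "k \<in> I \<union> J" for k
    proof -
      have "of_int \<bar>k\<bar> \<le> real n" using IJ[OF that] by linarith
      then have "(\<bar>real_of_int k\<bar> + real q) / d \<le> R" using d n by (simp add: R_def divide_right_mono)
      moreover have "1 / d > 0" using d by simp
      ultimately show ?thesis using small[of k] by linarith
    qed
    then have "\<exists>P. P holomorphic_on UNIV \<and> (\<forall>z. cmod z = R \<longrightarrow> cmod (P z) \<le> cmod (h z)) \<and>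
      cmod (P 0) = cmod (h 0) * (\<Prod>x\<in>S. R / cmod x)"
      by (intro divide_out_zeros h R) (auto simp: S_def I_def J_def x(3) nz)
    then obtain P where P: "P holomorphic_on UNIV" "\<And>z. cmod z = R \<Longrightarrow> cmod (P z) \<le> cmod (h z)"
      "cmod (P 0) = cmod (h 0) * (\<Prod>x\<in>S. R / cmod x)" by blast
    have "cmod (P 0) \<le> (C * (1 + R) ^ N) * exp (\<tau> * R / (m * sin (pi / (2 * m))))"
    proof (intro norm_at_0_le_rotation P R m d)
      show "cmod (P z) \<le> C * (1 + R) ^ N * exp (\<tau> * \<bar>Im z\<bar>)" if "cmod z = R" for z
        using P(2)[OF that] growth[of z] that by simp
    qed
    also have "\<tau> * R / (m * sin (pi / (2 * m))) = \<sigma> * L"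
      by (simp add: \<sigma>_def R_def)
    finally have up: "cmod (P 0) \<le> C * (1 + L / d) ^ N * exp (\<sigma> * L)" by (simp add: R_def)
    have fac: "L / (real i + q) \<le> R / \<bar>x k\<bar>" if "\<bar>k\<bar> = int i" for i k
    proof -
      have "real_of_int \<bar>k\<bar> = real i" using that by simp
      then have "\<bar>x k\<bar> \<le> (real i + q) / d - 1 / d" using small[of k] by simp
      moreover have "1 / d > 0" using d by simp
      ultimately have "\<bar>x k\<bar> \<le> (real i + q) / d" by linarith
      then have "R / ((real i + q) / d) \<le> R / \<bar>x k\<bar>"
        using R nz[of k] q d by (intro divide_left_mono) (auto intro!: mult_pos_pos divide_pos_pos add_nonneg_pos)
      then show ?thesis using d by (simp add: R_def)
    qed
    have "(\<Prod>x\<in>S. R / cmod x) = (\<Prod>k\<in>I \<union> J. R / \<bar>x k\<bar>)"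
      unfolding S_def by (subst prod.reindex[OF inj]) (simp add: o_def)
    also have "\<dots> = (\<Prod>k\<in>I. R / \<bar>x k\<bar>) * (\<Prod>k\<in>J. R / \<bar>x k\<bar>)"
      by (rule prod.union_disjoint) (auto simp: I_def J_def)
    also have "(\<Prod>k\<in>I. R / \<bar>x k\<bar>) = (\<Prod>i=1..n. R / \<bar>x (int i)\<bar>)"
      unfolding I_def by (subst prod.reindex) (auto simp: o_def inj_on_def)
    also have "(\<Prod>k\<in>J. R / \<bar>x k\<bar>) = (\<Prod>i=1..n. R / \<bar>x (- int i)\<bar>)"
      unfolding J_def by (subst prod.reindex) (auto simp: o_def inj_on_def)
    finally have prod_eq: "(\<Prod>x\<in>S. R / cmod x) =
      (\<Prod>i=1..n. R / \<bar>x (int i)\<bar>) * (\<Prod>i=1..n. R / \<bar>x (- int i)\<bar>)" .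
    have low: "exp (L - 1) / L ^ (q + 1) \<le> (\<Prod>i=1..n. R / \<bar>x (k i)\<bar>)" if "\<And>i. \<bar>k i\<bar> = int i" for k
    proof -
      have "exp (L - 1) / L ^ (q + 1) \<le> (\<Prod>i=1..n. L / real (i + q))"
        unfolding n by (rule prod_quotient_ge) (use q in auto)
      also have "\<dots> \<le> (\<Prod>i=1..n. R / \<bar>x (k i)\<bar>)"
        using fac[OF that] L by (intro prod_mono) auto
      finally show ?thesis .
    qed
    have "(exp (L - 1) / L ^ (q + 1)) ^ 2 \<le> (\<Prod>x\<in>S. R / cmod x)"
      unfolding prod_eq power2_eq_square using L R
      by (intro mult_mono low prod_nonneg) auto
    then show ?thesis using up P(3) mult_left_mono[of _ _ "cmod (h 0)"] by fastforce
  qed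
  define \<delta> where "\<delta> = 2 - \<sigma>"
  have \<delta>: "\<delta> > 0" using \<sigma> by (simp add: \<delta>_def)
  \<comment> \<open>The exponent is N from the growth of \<open>h\<close> plus 2 (q + 1) from the
    two half-lines, and exp 2 comes from exp(L - 1)^2. Dividing by the power of
    \<open>\<delta>\<close> makes \<open>\<delta> * L\<close> the argument of both the power and the
    exponential.\<close>
  define K where "K = C * (1 + 1 / d) ^ N * exp 2 / \<delta> ^ (2 * q + 2 + N)"
  have bnd2: "cmod (h 0) \<le> K * ((\<delta> * real (n + q)) ^ (2 * q + 2 + N) / exp (\<delta> * real (n + q)))" for n
  proof -
    define L where "L = real (n + q)"
    have L: "L \<ge> 1" using q by (simp add: L_def)
    have "cmod (h 0) * (exp (L - 1) / L ^ (q + 1)) ^ 2 \<le> C * (1 + L / d) ^ N * exp (\<sigma> * L)"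
      by (rule bnd) (simp add: L_def)
    also have "\<dots> \<le> C * ((1 + 1 / d) * L) ^ N * exp (\<sigma> * L)"
      using L d \<open>C \<ge> 0\<close> by (intro mult_right_mono mult_left_mono power_mono) (auto simp: algebra_simps)
    finally have "cmod (h 0) * exp (L - 1) ^ 2 \<le> C * ((1 + 1 / d) * L) ^ N * exp (\<sigma> * L) * (L ^ (q + 1)) ^ 2"
      using L by (simp add: power_divide field_simps)
    then have "cmod (h 0) \<le> C * ((1 + 1 / d) * L) ^ N * exp (\<sigma> * L) * (L ^ (q + 1)) ^ 2 / exp (L - 1) ^ 2"
      by (simp add: field_simps)
    also have "\<dots> = C * (1 + 1 / d) ^ N * L ^ (2 * q + 2 + N) * (exp (\<sigma> * L) / exp (L - 1) ^ 2)"
      by (simp add: power_mult_distrib power_add power2_eq_square mult_2 mult_2_right mult_ac)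
    also have "exp (\<sigma> * L) / exp (L - 1) ^ 2 = exp 2 / exp (\<delta> * L)"
      by (simp add: \<delta>_def power2_eq_square exp_add[symmetric] exp_diff[symmetric] algebra_simps)
    also have "C * (1 + 1 / d) ^ N * L ^ (2 * q + 2 + N) * (exp 2 / exp (\<delta> * L)) =
      K * ((\<delta> * L) ^ (2 * q + 2 + N) / exp (\<delta> * L))"
      using \<delta> by (simp add: K_def power_mult_distrib)
    finally show ?thesis by (simp add: L_def)
  qed
  have "(\<lambda>n. K * ((\<delta> * real (n + q)) ^ (2 * q + 2 + N) / exp (\<delta> * real (n + q)))) \<longlonglongrightarrow> K * 0"
  proof (intro tendsto_intros)
    have "filterlim (\<lambda>n. \<delta> * real (n + q)) at_top sequentially"
      using \<delta> by real_asymp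
    then show "(\<lambda>n. (\<delta> * real (n + q)) ^ (2 * q + 2 + N) / exp (\<delta> * real (n + q))) \<longlonglongrightarrow> 0"
      by (rule filterlim_compose[OF tendsto_power_div_exp_0])
  qed
  then have "cmod (h 0) \<le> K * 0"
    by (rule LIMSEQ_le_const) (use bnd2 in auto)
  then show False using h0 by simp
qed

lemma entire_zero_if_zero_on_reals:
  assumes h: "h holomorphic_on UNIV" and h_real: "\<And>a::real. h (of_real a) = 0"
  shows "h z = 0"
proof -
  have lim: "(0::complex) islimpt range of_real"
    unfolding islimpt_approachable
  proof (intro allI impI)
    fix e :: real assume "e > 0"
    then show "\<exists>y\<in>range of_real. y \<noteq> (0::complex) \<and> dist y 0 < e"
      by (intro bexI[OF _ rangeI[of of_real "e / 2"]]) (simp add: norm_divide)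
  qed
  show ?thesis
    by (rule analytic_continuation[OF h open_UNIV connected_UNIV subset_UNIV UNIV_I lim _ UNIV_I])
      (use h_real in blast)
qed

text \<open>The hypotheses survive a real translation: |Im z| is unchanged, and only the constants
  \<open>C\<close> and \<open>A\<close> worsen. So every real point can be made the origin, and
  \<open>h\<close> vanishes on the whole real line.\<close>

lemma zero_if_dense_zeros:
  fixes x :: "int \<Rightarrow> real"
  assumes h: "h holomorphic_on UNIV"
    and growth: "\<And>z. cmod (h z) \<le> C * (1 + cmod z) ^ N * exp (\<tau> * \<bar>Im z\<bar>)"
    and x: "inj x" "\<And>k. \<bar>x k - of_int k / d\<bar> \<le> A" "\<And>k. h (of_real (x k)) = 0"
    and d: "d > 0" "0 \<le> \<tau>" "\<tau> < pi * d"
  shows "h z = 0"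
proof -
  have "0 \<le> C"
    using order_trans[OF norm_ge_zero growth[of 0]] by simp
  have "h (of_real a) = 0" for a
  proof -
    have "h (0 + of_real a) = 0"
    proof (rule no_zero_at_0_of_growth[where h = "\<lambda>z. h (z + of_real a)" and x = "\<lambda>k. x k - a" and d = d])
      show "(\<lambda>z. h (z + of_real a)) holomorphic_on UNIV"
        by (rule holomorphic_on_compose_gen[OF _ h, unfolded o_def]) (auto intro!: holomorphic_intros)
      show "cmod (h (z + of_real a)) \<le> C * (1 + \<bar>a\<bar>) ^ N * (1 + cmod z) ^ N * exp (\<tau> * \<bar>Im z\<bar>)" for z
      proof -
        have "cmod (z + of_real a) \<le> cmod z + \<bar>a\<bar>" using norm_triangle_ineq[of z "of_real a"] by simp
        then have "1 + cmod (z + of_real a) \<le> (1 + \<bar>a\<bar>) * (1 + cmod z)"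
          using mult_nonneg_nonneg[OF abs_ge_zero[of a] norm_ge_zero[of z]]
          unfolding distrib_left distrib_right mult_1 mult_1_right by linarith
        then have "C * (1 + cmod (z + of_real a)) ^ N \<le> C * ((1 + \<bar>a\<bar>) * (1 + cmod z)) ^ N"
          using \<open>0 \<le> C\<close> by (intro mult_left_mono power_mono) auto
        then have "C * (1 + cmod (z + of_real a)) ^ N * exp (\<tau> * \<bar>Im z\<bar>) \<le> C * ((1 + \<bar>a\<bar>) * (1 + cmod z)) ^ N * exp (\<tau> * \<bar>Im z\<bar>)"
          by (rule mult_right_mono) auto
        then show ?thesis using growth[of "z + of_real a"] by (simp add: power_mult_distrib mult_ac)
      qed
      show "\<bar>x k - a - of_int k / d\<bar> \<le> A + \<bar>a\<bar>" for k using x(2)[of k] by linarith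
      show "inj (\<lambda>k. x k - a)" using x(1) by (simp add: inj_def)
      show "h (of_real (x k - a) + of_real a) = 0" for k using x(3)[of k] by simp
    qed (rule d)+
    then show ?thesis by simp
  qed
  then show ?thesis by (rule entire_zero_if_zero_on_reals[OF h])
qed

section \<open>The Paley--Wiener growth estimate\<close>

text \<open>A Peetre-type inequality: decay in t - z becomes decay in t at the price of a power of 1
  + |z|.\<close>

lemma one_plus_norm_le:
  fixes z :: complex
  shows "1 + \<bar>t\<bar> \<le> (1 + cmod z) * (1 + cmod (of_real t - z))"
proof -
  have "\<bar>t\<bar> \<le> cmod (of_real t - z) + cmod z"
    using norm_triangle_ineq[of "of_real t - z" z] by simp
  moreover have "0 \<le> cmod z * cmod (of_real t - z)" by simp
  ultimately show ?thesis unfolding distrib_left distrib_right mult_1 mult_1_right by linarith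
qed

text \<open>The cutoffs \<open>e n\<close> agree near the spectrum, so \<open>T (e n)\<close> does
  not depend on \<open>n\<close>. Its limit is c u(x), and its value at n = 0 is the integral of
  u(t) K(t - x). The latter makes sense for complex x and is bounded by the decay of
  \<open>K\<close>.\<close>

lemma PW_growth:
  fixes F :: "complex \<Rightarrow> complex"
  defines "u \<equiv> \<lambda>t. F (of_real t)"
  assumes F: "F holomorphic_on UNIV" and u: "tempered_function u"
    and supp: "dist_support (dist_fourier (regular_dist u)) \<subseteq> {- b / 2..b / 2}"
    and b: "0 < b" "b < B"
  shows "\<exists>C N. \<forall>z. cmod (F z) \<le> C * (1 + cmod z) ^ N * exp (pi * B * \<bar>Im z\<bar>)"
proof -
  \<comment> \<open>Between b/2 and B/2, so the plateau reaches beyond the spectrum on both sides.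
    The support radius A = B/2 gives \<open>K\<close> the exponent 2 \<pi> A = \<pi> B.\<close>
  define a where "a = (b / 2 + B / 2) / 2"
  define A where "A = B / 2"
  have ab: "0 < a" "b / 2 < a" "a < A" using b by (simp_all add: a_def A_def)
  define T where "T = dist_fourier (regular_dist u)"
  obtain \<eta> :: "real \<Rightarrow> real" where \<eta>: "smooth (\<lambda>t. complex_of_real (\<eta> t))"
    "\<And>t. \<bar>t\<bar> > A \<Longrightarrow> \<eta> t = 0" "\<And>t. \<bar>t\<bar> \<le> a \<Longrightarrow> \<eta> t = 1" "\<And>t. 0 \<le> \<eta> t"
    by (rule smooth_plateau_exists[OF ab(1,3)]) blast
  define \<phi> where "\<phi> = (\<lambda>t. complex_of_real (\<eta> t))"
  define K where "K = cfourier \<phi>"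
  define c where "c = (LINT s|lborel. K (of_real s))"
  have sm: "smooth \<phi>" unfolding \<phi>_def by (rule \<eta>(1))
  have z\<phi>: "\<phi> t = 0" if "\<bar>t\<bar> > A" for t using \<eta>(2)[OF that] by (simp add: \<phi>_def)
  have c0: "c \<noteq> 0" unfolding c_def K_def \<phi>_def
    by (rule integral_fourier_plateau_nonzero[OF \<eta>(1) _ \<eta>(3) \<eta>(4) ab(1)]) (erule \<eta>(2))
  have K_holo: "K holomorphic_on UNIV" unfolding K_def
    by (rule cfourier_holomorphic[OF smooth_continuous_on[OF sm]]) (erule z\<phi>)
  have u_cont: "continuous_on UNIV u" unfolding u_def
    by (rule continuous_on_compose2[OF holomorphic_on_imp_continuous_on[OF F]]) (auto intro!: continuous_intros)
  obtain N where N: "u \<in> borel_measurable lborel" "integrable lborel (\<lambda>t. cmod (u t) / (1 + \<bar>t\<bar>) ^ N)"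
    using u unfolding tempered_function_def by blast
  have repr: "c * u x = (LINT t|lborel. u t * K (of_real t - of_real x))" for x
  proof -
    define e where "e n \<omega> = \<phi> (\<omega> / real (Suc n)) * exp (2 * of_real pi * \<i> * of_real x * of_real \<omega>)" for n \<omega>
    have e_sm: "smooth (e n)" for n
    proof -
      have "smooth (\<lambda>\<omega>. \<phi> (1 / real (Suc n) * \<omega> + 0) * exp ((2 * of_real pi * \<i> * of_real x) * of_real \<omega>))"
        by (rule smooth_mult[OF smooth_affine[OF sm] smooth_exp])
      then show ?thesis unfolding e_def[abs_def] by simp
    qed
    \<comment> \<open>One radius has to serve both \<open>e n\<close> and \<open>e 0\<close>, since
      \<open>dist_fourier_add\<close> takes a common bound on the supports.\<close>
    have e_zero: "e k \<omega> = 0" if "\<bar>\<omega>\<bar> > real (Suc n) * A" "k \<le> n" for k n \<omega>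
    proof -
      have "real (Suc k) * A \<le> real (Suc n) * A" using that(2) ab by (intro mult_right_mono) auto
      then have "\<bar>\<omega>\<bar> > A * real (Suc k)" using that(1) by (simp add: mult.commute)
      then have "\<bar>\<omega> / real (Suc k)\<bar> > A" unfolding abs_divide by (simp add: pos_less_divide_eq)
      then show ?thesis unfolding e_def using z\<phi> by simp
    qed
    have e_one: "e n \<omega> = e 0 \<omega>" if "\<bar>\<omega>\<bar> < a" for n \<omega>
    proof -
      have "\<bar>\<omega> / real (Suc n)\<bar> \<le> \<bar>\<omega>\<bar>" unfolding abs_divide by (simp add: divide_le_eq mult_le_cancel_left1)
      then have "\<eta> (\<omega> / real (Suc n)) = 1" "\<eta> (\<omega> / real (Suc 0)) = 1"
        using that by (simp_all add: \<eta>(3))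
      then show ?thesis by (simp add: e_def \<phi>_def)
    qed
    have T_e: "T (e n) = (LINT t|lborel. u t * (of_nat (Suc n) * K (of_real (real (Suc n) * (t - x)))))" for n
      unfolding T_def dist_fourier_def regular_dist_def e_def[abs_def] K_def
      by (subst fourier_dilate_modulate) simp_all
    have T_const: "T (e n) = T (e 0)" for n
    proof -
      define d where "d \<omega> = e n \<omega> - e 0 \<omega>" for \<omega>
      have d_sm: "smooth d" unfolding d_def[abs_def] by (rule smooth_diff[OF e_sm e_sm])
      have d_zero: "d \<omega> = 0" if "\<bar>\<omega>\<bar> > real (Suc n) * A" for \<omega>
        unfolding d_def using e_zero[OF that, of n] e_zero[OF that, of 0] by simp
      have d_in: "d \<omega> = 0" if "\<bar>\<omega>\<bar> < a" for \<omega>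
        unfolding d_def using e_one[OF that, of n] by simp
      have "dist_support (dist_fourier (regular_dist u)) \<subseteq> {- (b / 2)..b / 2}"
        using supp by simp
      then have "T d = 0" unfolding T_def
        by (rule dist_fourier_vanishes[OF u _ ab(2) d_sm]) (erule d_zero, erule d_in)
      moreover have "T (\<lambda>\<omega>. e 0 \<omega> + d \<omega>) = T (e 0) + T d" unfolding T_def
        by (rule dist_fourier_add[OF u e_sm _ d_sm]) (erule e_zero, simp, erule d_zero)
      moreover have "(\<lambda>\<omega>. e 0 \<omega> + d \<omega>) = e n" by (simp add: d_def)
      ultimately show ?thesis by simp
    qed
    obtain C where C: "\<And>s. cmod (cfourier \<phi> (of_real s)) \<le> C / (1 + \<bar>s\<bar>) ^ (N + 2)"
      by (rule cfourier_real_bound[OF sm, where A = A and N = "N + 2"]) (erule z\<phi>, rule that)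
    have "(\<lambda>n. LINT t|lborel. u t * (of_nat (Suc n) * K (of_real (real (Suc n) * (t - x))))) \<longlonglongrightarrow> u x * c"
      unfolding c_def
    proof (rule approx_identity[OF u_cont N(2)])
      show "continuous_on UNIV (\<lambda>s. K (of_real s))" unfolding K_def
        by (rule continuous_on_cfourier_real[OF sm]) (erule z\<phi>)
      show "integrable lborel (\<lambda>s. K (of_real s))" unfolding K_def
        by (rule integrable_fourier_test[OF sm]) (erule z\<phi>)
      show "cmod (K (of_real s)) \<le> C / (1 + \<bar>s\<bar>) ^ (N + 2)" for s unfolding K_def by (rule C)
    qed
    then have lim: "(\<lambda>n. T (e n)) \<longlonglongrightarrow> u x * c"
      unfolding T_e .
    define r where "r = T (e 0)"
    have "(\<lambda>n. T (e n)) = (\<lambda>_. r)" unfolding r_def by (rule ext) (rule T_const)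
    then have "u x * c = r" using lim LIMSEQ_unique tendsto_const by metis
    then show ?thesis unfolding r_def T_e by (simp add: mult.commute)
  qed
  obtain C where C: "C \<ge> 0" "\<And>w. cmod (K w) \<le> C * exp (2 * pi * A * \<bar>Im w\<bar>) / (1 + cmod w) ^ N"
    by (rule cfourier_decay[OF sm, where A = A and N = N, folded K_def]) (erule z\<phi>, rule that)
  define E where "E z = C * exp (pi * B * \<bar>Im z\<bar>) * (1 + cmod z) ^ N" for z
  have E0: "E z \<ge> 0" for z using C(1) by (simp add: E_def)
  have K_bound: "cmod (K (of_real t - z)) \<le> E z / (1 + \<bar>t\<bar>) ^ N" for t z
  proof -
    define r where "r = 1 + cmod (of_real t - z)"
    have r: "r > 0" by (simp add: r_def add_pos_nonneg)
    have "(1 + \<bar>t\<bar>) ^ N \<le> ((1 + cmod z) * r) ^ N"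
      using one_plus_norm_le[of t z] by (intro power_mono) (auto simp: r_def)
    then have le: "(1 + \<bar>t\<bar>) ^ N \<le> (1 + cmod z) ^ N * r ^ N" by (simp only: power_mult_distrib)
    have "1 / Q \<le> S / P" if "P \<le> S * Q" "P > 0" "Q > 0" for P Q S :: real
      using that by (simp add: field_simps)
    from this[OF le] have "1 / r ^ N \<le> (1 + cmod z) ^ N / (1 + \<bar>t\<bar>) ^ N"
      using r by (simp add: add_pos_nonneg)
    then have "(C * exp (pi * B * \<bar>Im z\<bar>)) * (1 / r ^ N) \<le>
      (C * exp (pi * B * \<bar>Im z\<bar>)) * ((1 + cmod z) ^ N / (1 + \<bar>t\<bar>) ^ N)"
      using C(1) by (intro mult_left_mono) auto
    then show ?thesis using C(2)[of "of_real t - z"] by (simp add: E_def r_def A_def)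
  qed
  define I where "I = (LINT t|lborel. cmod (u t) / (1 + \<bar>t\<bar>) ^ N)"
  define V where "V z = (LINT t|lborel. u t * K (of_real t - z))" for z
  have K_cont: "continuous_on S (\<lambda>t. K (of_real t - z))" for S z
    by (rule continuous_on_compose2[OF holomorphic_on_imp_continuous_on[OF K_holo]])
      (auto intro!: continuous_intros)
  have uK_bound: "cmod (u t * K (of_real t - z)) \<le> E z * (cmod (u t) / (1 + \<bar>t\<bar>) ^ N)" for t z
  proof -
    have "cmod (u t * K (of_real t - z)) \<le> cmod (u t) * (E z / (1 + \<bar>t\<bar>) ^ N)"
      unfolding norm_mult by (rule mult_left_mono[OF K_bound]) simp
    then show ?thesis by (simp add: mult.commute)
  qed
  have Vint: "integrable lborel (\<lambda>t. u t * K (of_real t - z))" for z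
  proof (rule integrable_tempered_mult[OF N(1) _ N(2)])
    show "(\<lambda>t. K (of_real t - z)) \<in> borel_measurable lborel"
      unfolding measurable_lborel2 by (rule borel_measurable_continuous_onI[OF K_cont])
  qed (rule K_bound)
  have V_bound: "cmod (V z) \<le> E z * I" for z
  proof -
    have "cmod (V z) \<le> (LINT t|lborel. E z * (cmod (u t) / (1 + \<bar>t\<bar>) ^ N))"
      unfolding V_def
      by (rule Bochner_Integration.integral_norm_bound_integral[OF Vint integrable_mult_right[OF N(2)] uK_bound])
    also have "\<dots> = E z * I" unfolding I_def by (rule integral_mult_right_zero)
    finally show ?thesis .
  qed
  \<comment> \<open>Truncation to a compact interval permits differentiation under the integral.
    \<open>V\<close> is then holomorphic as a locally uniform limit of the
    \<open>W n\<close>.\<close>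
  define W where "W n z = (LINT t|lborel. indicator {- real n..real n} t *\<^sub>R (u t * K (of_real t - z)))" for n z
  have W_holo: "W n holomorphic_on UNIV" for n
  proof -
    let ?f = "\<lambda>z t. u t * K (of_real t - z)"
    have cont: "continuous_on S (?f z)" for S z
      by (rule continuous_on_mult[OF continuous_on_subset[OF u_cont subset_UNIV] K_cont])
    have eq: "W n z = integral (cbox (- real n) (real n)) (?f z)" for z
      unfolding W_def
      using set_borel_integral_eq_integral(2)[OF borel_integrable_atLeastAtMost'[OF cont]]
      by (simp add: set_lebesgue_integral_def)
    have dK: "(K has_field_derivative deriv K w) (at w)" for w
      by (rule holomorphic_derivI[OF K_holo]) auto
    have "(\<lambda>z. integral (cbox (- real n) (real n)) (?f z)) holomorphic_on UNIV"
    proof (rule leibniz_rule_holomorphic)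
      show "((\<lambda>z. ?f z t) has_field_derivative u t * (deriv K (of_real t - z) * - 1)) (at z within UNIV)" for z t
        by (rule DERIV_cmult, rule DERIV_chain2[OF dK]) (auto intro!: derivative_eq_intros)
      show "?f z integrable_on cbox (- real n) (real n)" for z
        by (rule integrable_continuous[OF cont])
      have dK_cont: "continuous_on UNIV (deriv K)"
        by (rule holomorphic_on_imp_continuous_on[OF holomorphic_deriv[OF K_holo open_UNIV]])
      show "continuous_on (UNIV \<times> cbox (- real n) (real n)) (\<lambda>(z, t). u t * (deriv K (of_real t - z) * - 1))"
        unfolding case_prod_unfold
      proof (intro continuous_on_mult continuous_on_const)
        show "continuous_on (UNIV \<times> cbox (- real n) (real n)) (\<lambda>p. u (snd p))"
          by (rule continuous_on_compose2[OF u_cont]) (auto intro!: continuous_intros)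
        show "continuous_on (UNIV \<times> cbox (- real n) (real n)) (\<lambda>p. deriv K (of_real (snd p) - fst p))"
          by (rule continuous_on_compose2[OF dK_cont]) (auto intro!: continuous_intros)
      qed
    qed auto
    then show ?thesis unfolding eq[abs_def] .
  qed
  \<comment> \<open>The tail of the weighted integral. It does not depend on \<open>z\<close>, so
    the error \<open>E z * \<rho> n\<close> is uniform wherever \<open>E\<close> is bounded.\<close>
  define \<rho> where "\<rho> n = (LINT t|lborel. indicator (- {- real n..real n}) t *\<^sub>R (cmod (u t) / (1 + \<bar>t\<bar>) ^ N))" for n
  have [measurable]: "u \<in> borel_measurable borel" using N(1) by simp
  have \<rho>_int: "integrable lborel (\<lambda>t. indicator (- {- real n..real n}) t *\<^sub>R (cmod (u t) / (1 + \<bar>t\<bar>) ^ N))" for n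
    by (rule integrable_mult_indicator[OF _ N(2)]) simp
  have \<rho>_lim: "\<rho> \<longlonglongrightarrow> 0"
  proof -
    have "\<rho> \<longlonglongrightarrow> (LINT t|(lborel :: real measure). (0::real))"
      unfolding \<rho>_def
    proof (rule integral_dominated_convergence[where w = "\<lambda>t. cmod (u t) / (1 + \<bar>t\<bar>) ^ N"])
      show "integrable lborel (\<lambda>t. cmod (u t) / (1 + \<bar>t\<bar>) ^ N)" by (rule N(2))
      show "AE t in lborel. (\<lambda>n. indicator (- {- real n..real n}) t *\<^sub>R (cmod (u t) / (1 + \<bar>t\<bar>) ^ N)) \<longlonglongrightarrow> 0"
      proof (rule AE_I2)
        fix t :: real
        obtain k :: nat where k: "\<bar>t\<bar> \<le> real k" using real_arch_simple by blast
        show "(\<lambda>n. indicator (- {- real n..real n}) t *\<^sub>R (cmod (u t) / (1 + \<bar>t\<bar>) ^ N)) \<longlonglongrightarrow> 0"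
        proof (rule tendsto_eventually[OF eventually_sequentiallyI[of k]])
          fix n assume "k \<le> n"
          then have "real k \<le> real n" by simp
          then have "t \<in> {- real n..real n}" using k unfolding atLeastAtMost_iff by linarith
          then show "indicator (- {- real n..real n}) t *\<^sub>R (cmod (u t) / (1 + \<bar>t\<bar>) ^ N) = 0" by simp
        qed
      qed
      show "AE t in lborel. norm (indicator (- {- real n..real n}) t *\<^sub>R (cmod (u t) / (1 + \<bar>t\<bar>) ^ N))
        \<le> cmod (u t) / (1 + \<bar>t\<bar>) ^ N" for n
        by (rule AE_I2) (simp add: indicator_def)
    qed measurable
    then show ?thesis by simp
  qed
  have VW: "cmod (W n z - V z) \<le> E z * \<rho> n" for n z
  proof -
    have "V z - W n z = (LINT t|lborel. (u t * K (of_real t - z)) - indicator {- real n..real n} t *\<^sub>R (u t * K (of_real t - z)))"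
      unfolding V_def W_def
      by (rule Bochner_Integration.integral_diff[symmetric, OF Vint integrable_mult_indicator[OF _ Vint]]) simp
    also have "\<dots> = (LINT t|lborel. indicator (- {- real n..real n}) t *\<^sub>R (u t * K (of_real t - z)))"
      by (rule Bochner_Integration.integral_cong[OF refl]) (simp add: indicator_def)
    also have "cmod \<dots> \<le> (LINT t|lborel. E z * (indicator (- {- real n..real n}) t *\<^sub>R (cmod (u t) / (1 + \<bar>t\<bar>) ^ N)))"
    proof (rule Bochner_Integration.integral_norm_bound_integral)
      show "integrable lborel (\<lambda>t. indicator (- {- real n..real n}) t *\<^sub>R (u t * K (of_real t - z)))"
        by (rule integrable_mult_indicator[OF _ Vint]) simp
      show "integrable lborel (\<lambda>t. E z * (indicator (- {- real n..real n}) t *\<^sub>R (cmod (u t) / (1 + \<bar>t\<bar>) ^ N)))"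
        by (rule integrable_mult_right[OF \<rho>_int])
      show "cmod (indicator (- {- real n..real n}) t *\<^sub>R (u t * K (of_real t - z))) \<le>
        E z * (indicator (- {- real n..real n}) t *\<^sub>R (cmod (u t) / (1 + \<bar>t\<bar>) ^ N))" for t
        using uK_bound[of t z] by (cases "t \<in> {- real n..real n}") simp_all
    qed
    also have "\<dots> = E z * \<rho> n" unfolding \<rho>_def by (rule integral_mult_right_zero)
    finally show ?thesis by (simp add: norm_minus_commute)
  qed
  have \<rho>0: "\<rho> n \<ge> 0" for n unfolding \<rho>_def by (rule Bochner_Integration.integral_nonneg) simp
  have V_holo: "V holomorphic_on UNIV"
  proof (rule holomorphic_uniform_sequence[OF open_UNIV W_holo])
    fix z :: complex
    \<comment> \<open>A bound for \<open>E\<close> on the unit ball about \<open>z\<close>: both |Im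
      w| and |w| grow by at most 1 there.\<close>
    define D where "D = C * exp (pi * B * (\<bar>Im z\<bar> + 1)) * (2 + cmod z) ^ N"
    have ED: "E w \<le> D" if "w \<in> cball z 1" for w
    proof -
      have wz: "cmod (w - z) \<le> 1" using that by (simp add: dist_norm norm_minus_commute)
      have "\<bar>Im w\<bar> \<le> \<bar>Im z\<bar> + 1" using abs_Im_le_cmod[of "w - z"] wz by simp
      moreover have "1 + cmod w \<le> 2 + cmod z" using norm_triangle_ineq[of "w - z" z] wz by simp
      ultimately show ?thesis unfolding E_def D_def using C(1) b
        by (intro mult_mono power_mono mult_left_mono iffD2[OF exp_le_cancel_iff]) auto
    qed
    have "uniform_limit (cball z 1) W V sequentially"
    proof (rule uniform_limitI)
      fix \<epsilon> :: real assume "\<epsilon> > 0"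
      have "(\<lambda>n. D * \<rho> n) \<longlonglongrightarrow> D * 0" by (rule tendsto_mult_left[OF \<rho>_lim])
      then have "eventually (\<lambda>n. D * \<rho> n < \<epsilon>) sequentially"
        using \<open>\<epsilon> > 0\<close> by (intro order_tendstoD(2)[where y = "D * 0"]) auto
      then show "\<forall>\<^sub>F n in sequentially. \<forall>w\<in>cball z 1. dist (W n w) (V w) < \<epsilon>"
      proof (rule eventually_mono, intro ballI)
        fix n w assume "D * \<rho> n < \<epsilon>" "w \<in> cball z 1"
        then show "dist (W n w) (V w) < \<epsilon>"
          using VW[of n w] mult_right_mono[OF ED \<rho>0, of w n] unfolding dist_norm by linarith
      qed
    qed
    then show "\<exists>d. 0 < d \<and> cball z d \<subseteq> UNIV \<and> uniform_limit (cball z d) W V sequentially"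
      by (intro exI[of _ 1]) simp
  qed
  have "c * F z - V z = 0" for z
  proof (rule entire_zero_if_zero_on_reals[where h = "\<lambda>z. c * F z - V z"])
    show "(\<lambda>z. c * F z - V z) holomorphic_on UNIV"
      by (intro holomorphic_on_diff holomorphic_on_mult holomorphic_on_const F V_holo)
    show "c * F (of_real x) - V (of_real x) = 0" for x :: real
      using repr[of x] by (simp add: u_def V_def)
  qed
  then have F_eq: "F z = V z / c" for z using c0 by (simp add: field_simps)
  have "cmod (F z) \<le> (C * I / cmod c) * (1 + cmod z) ^ N * exp (pi * B * \<bar>Im z\<bar>)" for z
  proof -
    have "cmod (F z) \<le> E z * I / cmod c"
      unfolding F_eq norm_divide by (rule divide_right_mono[OF V_bound]) simp
    then show ?thesis by (simp add: E_def mult_ac)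
  qed
  then show ?thesis by blast
qed

section \<open>Uniqueness up to sign\<close>

theorem theorem1:
  fixes p :: ennreal and b :: real
    and f g :: "complex \<Rightarrow> complex" and x :: "int \<Rightarrow> real"
  assumes "p > 0" and "b > 0"
    and "f \<in> PW p b" and "real_on_reals f"
    and "strict_mono x" and "separated x" and "uniformly_dense x"
    and "uniform_density x > 2 * b"
    and "g \<in> PW p b" and "real_on_reals g"
    and "\<And>k. cmod (g (of_real (x k))) = cmod (f (of_real (x k)))"
  shows "g = f \<or> g = (\<lambda>z. - f z)"
proof -
  define d where "d = uniform_density x"
  have dens: "has_uniform_density x d"
    using assms(7) uniform_density_eq unfolding uniformly_dense_def d_def by metis
  then obtain A where A: "\<And>k. \<bar>x k - of_int k / d\<bar> \<le> A"
    unfolding has_uniform_density_def bdd_above_def by auto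
  have d: "d > 2 * b" using assms(8) by (simp add: d_def)
  \<comment> \<open>Midway between b and d/2: above b to leave room for the cutoff, below d/2 so
    that the exponent 2 \<pi> B of \<open>h\<close> stays under \<pi> d.\<close>
  define B where "B = (b + d / 2) / 2"
  have B: "b < B" "2 * B < d" using d by (simp_all add: B_def)
  have holo: "f holomorphic_on UNIV" "g holomorphic_on UNIV"
    using assms(3,9) by (simp_all add: PW_def)
  have growth: "\<exists>C N. \<forall>z. cmod (F z) \<le> C * (1 + cmod z) ^ N * exp (pi * B * \<bar>Im z\<bar>)"
    if "F \<in> PW p b" for F
    using that by (intro PW_growth[OF _ _ _ assms(2) B(1)]) (simp_all add: PW_def PW_real_def)
  obtain Cf Nf where Cf: "\<And>z. cmod (f z) \<le> Cf * (1 + cmod z) ^ Nf * exp (pi * B * \<bar>Im z\<bar>)"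
    using growth[OF assms(3)] by blast
  obtain Cg Ng where Cg: "\<And>z. cmod (g z) \<le> Cg * (1 + cmod z) ^ Ng * exp (pi * B * \<bar>Im z\<bar>)"
    using growth[OF assms(9)] by blast
  define N where "N = Nf + Ng"
  define C where "C = Cf + Cg"
  have "0 \<le> Cf" using order_trans[OF norm_ge_zero Cf[of 0]] by simp
  have "0 \<le> Cg" using order_trans[OF norm_ge_zero Cg[of 0]] by simp
  have le: "cmod (F z) \<le> C0 * (1 + cmod z) ^ N * exp (pi * B * \<bar>Im z\<bar>)"
    if "cmod (F z) \<le> C0 * (1 + cmod z) ^ N0 * exp (pi * B * \<bar>Im z\<bar>)" "0 \<le> C0" "N0 \<le> N"
    for F :: "complex \<Rightarrow> complex" and C0 N0 z
  proof -
    have "(1 + cmod z) ^ N0 \<le> (1 + cmod z) ^ N" using that(3) by (intro power_increasing) auto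
    then have "C0 * (1 + cmod z) ^ N0 * exp (pi * B * \<bar>Im z\<bar>) \<le> C0 * (1 + cmod z) ^ N * exp (pi * B * \<bar>Im z\<bar>)"
      using that(2) by (intro mult_right_mono mult_left_mono) auto
    then show ?thesis using that(1) by linarith
  qed
  have sum_growth: "cmod (f z) + cmod (g z) \<le> C * (1 + cmod z) ^ N * exp (pi * B * \<bar>Im z\<bar>)" for z
  proof -
    have "cmod (f z) \<le> Cf * (1 + cmod z) ^ N * exp (pi * B * \<bar>Im z\<bar>)"
      by (rule le[OF Cf \<open>0 \<le> Cf\<close>]) (simp add: N_def)
    moreover have "cmod (g z) \<le> Cg * (1 + cmod z) ^ N * exp (pi * B * \<bar>Im z\<bar>)"
      by (rule le[OF Cg \<open>0 \<le> Cg\<close>]) (simp add: N_def)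
    ultimately show ?thesis unfolding C_def distrib_right by linarith
  qed
  define h where "h z = (f z - g z) * (f z + g z)" for z
  have "h z = 0" for z
  proof (rule zero_if_dense_zeros[where h = h and x = x and d = d])
    show "h holomorphic_on UNIV" unfolding h_def[abs_def]
      by (intro holomorphic_on_mult holomorphic_on_diff holomorphic_on_add holo)
    show "cmod (h z) \<le> C\<^sup>2 * (1 + cmod z) ^ (2 * N) * exp (2 * pi * B * \<bar>Im z\<bar>)" for z
    proof -
      \<comment> \<open>Both factors of \<open>h\<close> are at most |f| + |g|, so a single bound is
        squared, which doubles the exponent.\<close>
      have "cmod (h z) \<le> (cmod (f z) + cmod (g z)) * (cmod (f z) + cmod (g z))"
        unfolding h_def norm_mult by (intro mult_mono norm_triangle_ineq4 norm_triangle_ineq) auto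
      also have "\<dots> \<le> (C * (1 + cmod z) ^ N * exp (pi * B * \<bar>Im z\<bar>)) * (C * (1 + cmod z) ^ N * exp (pi * B * \<bar>Im z\<bar>))"
        using order_trans[OF _ sum_growth[of z]] by (intro mult_mono sum_growth) auto
      also have "\<dots> = C\<^sup>2 * (1 + cmod z) ^ (2 * N) * exp (2 * pi * B * \<bar>Im z\<bar>)"
      proof -
        have "exp (2 * pi * B * \<bar>Im z\<bar>) = exp (pi * B * \<bar>Im z\<bar>) * exp (pi * B * \<bar>Im z\<bar>)"
          by (simp flip: exp_add)
        moreover have "(1 + cmod z) ^ (2 * N) = (1 + cmod z) ^ N * (1 + cmod z) ^ N"
          by (simp add: mult_2 power_add)
        ultimately show ?thesis by (simp only: power2_eq_square mult_ac)
      qed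
      finally show ?thesis .
    qed
    show "inj x" using assms(5) by (rule strict_mono_imp_inj_on)
    show "\<bar>x k - of_int k / d\<bar> \<le> A" for k by (rule A)
    show "h (of_real (x k)) = 0" for k
    proof -
      obtain r s where rs: "f (of_real (x k)) = of_real r" "g (of_real (x k)) = of_real s"
        using assms(4,10) unfolding real_on_reals_def by (meson Reals_cases)
      have "\<bar>s\<bar> = \<bar>r\<bar>" using assms(11)[of k] unfolding rs by simp
      then have "s = r \<or> s = - r" by linarith
      then show ?thesis unfolding h_def rs by auto
    qed
    show "d > 0" using d assms(2) by linarith
    show "0 \<le> 2 * pi * B" "2 * pi * B < pi * d" using B assms(2) by simp_all
  qed
  have diff_holo: "(\<lambda>z. f z - g z) holomorphic_on UNIV" "(\<lambda>z. f z + g z) holomorphic_on UNIV"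
    by (intro holomorphic_on_diff holomorphic_on_add holo)+
  show ?thesis
  proof (cases "\<exists>w. f w \<noteq> g w")
    case False
    then show ?thesis by auto
  next
    case True
    then obtain w where w: "f w - g w \<noteq> 0" by auto
    \<comment> \<open>The open set where f and g differ contains \<open>w\<close>, which is
      therefore a limit point of it. There h = 0 forces f + g = 0, and the identity theorem spreads
      this to the whole plane.\<close>
    have "open ((\<lambda>z. f z - g z) -` (- {0}))"
      by (rule open_vimage[OF _ holomorphic_on_imp_continuous_on[OF diff_holo(1)]]) auto
    then have lim: "w islimpt ((\<lambda>z. f z - g z) -` (- {0}))"
      by (intro interior_limit_point) (use w in \<open>simp add: interior_open\<close>)
    have "f z + g z = 0" for z
    proof (rule analytic_continuation[OF diff_holo(2) open_UNIV connected_UNIV subset_UNIV UNIV_I lim _ UNIV_I])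
      show "f z + g z = 0" if "z \<in> (\<lambda>z. f z - g z) -` (- {0})" for z
        using that \<open>h z = 0\<close> by (simp add: h_def)
    qed
    then have "g z = - f z" for z by (simp add: add_eq_0_iff)
    then show ?thesis by auto
  qed
qed

end
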